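(* There is a universal constant $C<\infty$ such that if $v\in W^{1,2}(\mathbb{D})$ is real-valued with $\int_{\partial\mathbb{D}}v^\star(e^{i\theta})\,d\theta=0$ and $$\int_{\mathbb{D}}|\nabla v(z)|^2\,\frac{dA(z)}{\pi}\le1,$$ then $$\int_0^{2\pi}\exp\left(v^\star(e^{i\theta})^2\right)d\theta\le C,$$ where $v^\star$ is the Sobolev trace of $v$ on $\partial\mathbb{D}$.
   Context: $\mathbb{D}=\{z\in\mathbb{C}:|z|<1\}$ is the unit disk, $dA$ is area (two-dimensional Lebesgue) measure, and $W^{1,2}(\mathbb{D})$ is the usual Sobolev space of real-valued $L^2$ functions with weak gradient in $L^2$. The Sobolev trace is the usual boundary trace of a $W^{1,2}(\mathbb{D})$ function. *)

theory Defs
  imports "HOL-Analysis.Analysis"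
begin

definition grad :: "('a::euclidean_space \<Rightarrow> real) \<Rightarrow> 'a \<Rightarrow> 'a" where
  "grad f x = (\<Sum>b\<in>Basis. frechet_derivative f (at x) b *\<^sub>R b)"

primrec C_k :: "nat \<Rightarrow> ('a::euclidean_space \<Rightarrow> real) \<Rightarrow> bool" where
  "C_k 0 f \<longleftrightarrow> continuous_on UNIV f"
| "C_k (Suc k) f \<longleftrightarrow> (\<forall>x. f differentiable at x) \<and> (\<forall>b\<in>Basis. C_k k (\<lambda>x. grad f x \<bullet> b))"

definition smooth :: "('a::euclidean_space \<Rightarrow> real) \<Rightarrow> bool" where
  "smooth f \<longleftrightarrow> (\<forall>k. C_k k f)"

definition test_functions :: "'a::euclidean_space set \<Rightarrow> ('a \<Rightarrow> real) set" where
  "test_functions S =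
     {\<phi>. smooth \<phi> \<and> compact (closure {x. \<phi> x \<noteq> 0}) \<and> closure {x. \<phi> x \<noteq> 0} \<subseteq> S}"

text \<open>Elements of \<open>L2\<close> and \<open>W12\<close> are functions, not equivalence classes modulo null sets.
  Values outside \<open>S\<close> are irrelevant.\<close>

definition L2 :: "'a::euclidean_space set \<Rightarrow> ('a \<Rightarrow> 'b::euclidean_space) set" where
  "L2 S = {f. f \<in> borel_measurable (lebesgue_on S) \<and>
              integrable (lebesgue_on S) (\<lambda>x. (norm (f x))\<^sup>2)}"

definition has_weak_gradient ::
    "'a::euclidean_space set \<Rightarrow> ('a \<Rightarrow> real) \<Rightarrow> ('a \<Rightarrow> 'a) \<Rightarrow> bool" where
  "has_weak_gradient S u G \<longleftrightarrow> (\<forall>\<phi>\<in>test_functions S.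
     (LINT x|lebesgue_on S. u x *\<^sub>R grad \<phi> x) = - (LINT x|lebesgue_on S. \<phi> x *\<^sub>R G x))"

definition W12 :: "'a::euclidean_space set \<Rightarrow> ('a \<Rightarrow> real) set" where
  "W12 S = {u. u \<in> L2 S \<and> (\<exists>G. G \<in> L2 S \<and> has_weak_gradient S u G)}"

text \<open>For open \<open>S\<close> and \<open>u \<in> W12 S\<close>, the weak gradient is determined up to a null subset of \<open>S\<close>;
  the choice below picks one representative.\<close>

definition weak_gradient :: "'a::euclidean_space set \<Rightarrow> ('a \<Rightarrow> real) \<Rightarrow> 'a \<Rightarrow> 'a" where
  "weak_gradient S u = (SOME G. G \<in> L2 S \<and> has_weak_gradient S u G)"

text \<open>The trace operator is the continuous extension of \<open>u \<mapsto> u|\<partial>\<D>\<close> from the functions smooth up to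
  the boundary (the restrictions of smooth functions on the plane), which are dense in
  \<open>W12 \<D>\<close>, to a map from \<open>W12 \<D>\<close> into \<open>L\<^sup>2\<close> of the circle.  As the trace is determined
  only almost everywhere, it is given as a relation: \<open>g\<close>, of which only the values on the unit
  circle matter, is a representative of the trace of \<open>v\<close>.\<close>

definition has_trace_disk :: "(complex \<Rightarrow> real) \<Rightarrow> (complex \<Rightarrow> real) \<Rightarrow> bool" where
  "has_trace_disk v g \<longleftrightarrow>
     (\<lambda>\<theta>. g (cis \<theta>)) \<in> L2 {0..2*pi} \<and>
     (\<exists>u :: nat \<Rightarrow> complex \<Rightarrow> real.
        (\<forall>n. smooth (u n)) \<and>
        (\<lambda>n. LINT z|lebesgue_on (ball 0 1). (u n z - v z)\<^sup>2) \<longlonglongrightarrow> 0 \<and>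
        (\<lambda>n. LINT z|lebesgue_on (ball 0 1).
               (norm (grad (u n) z - weak_gradient (ball 0 1) v z))\<^sup>2) \<longlonglongrightarrow> 0 \<and>
        (\<lambda>n. LINT \<theta>|lebesgue_on {0..2*pi}. (u n (cis \<theta>) - g (cis \<theta>))\<^sup>2) \<longlonglongrightarrow> 0)"

end

(* Let w be C^1 on the plane and E a Borel set of angles.  Pairing the gradient of w with that of the
   Neumann solution whose boundary flux is a partial Fourier sum of 1_E / |E| bounds the difference
   between the average of w over E and its mean by sqrt (D(w) / pi) * sqrt (ln (2 pi / |E|) + 3),
   where D is the Dirichlet energy: the Fourier coefficients m_n of 1_E / |E| satisfy |m_n| <= 1 and
   Bessel's inequality, so that the sum of |m_n|^2 / n is at most ln (2 pi / |E|) + 3.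

   For u with mean 0 and D(u) <= pi, write x(t) = ln (2 pi / |{u >= t}|) + 3.  Applied to u itself the
   estimate gives only t^2 <= x(t), which is not enough at the critical exponent.  Applied to f(u), where
   f has one slope below a level t1 and another above it, it also exploits the splitting of the energy at
   t1: if x(t) - t^2 <= l at two levels t1 < t2, and x(t1) >= 8 l, then most of the energy is spent
   below t1, which forces t2^2 - t1^2 <= K l.  Hence {t^2. x(t) - t^2 <= l} is covered by intervals of
   total length O(l), and the layer-cake formula bounds the integral of exp (u^2).  This is the argument
   of Garsia and Adams for Moser's inequality, carried out on level sets.

   The general case follows by normalising the smooth approximations and Fatou's lemma. *)

theory Submission
  imports Defs
begin

section \<open>Polar coordinates on the disk\<close>

text \<open>With y = t^2 the layer-cake integrand exp y * |{u >= sqrt y}| equals 2 pi exp 3 exp (-(x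
  - y)). The bound y <= x only makes it bounded on an unbounded range of y; what matters is how long
  x - y can stay below a given l. The reason it cannot stay long: let the energy (divided by pi)
  split at t1 as e1 + e2 <= 1. Optimising the two slopes turns the average estimate for f(u) into
  t1^2 / e1 + (t2 - t1)^2 / e2 <= x2, up to a small error. From t1^2 <= e1 x1 and x1 - t1^2 <= l
  follows e2 <= l / x1, so (t2 - t1)^2 x1 / l <= t2^2 - t1^2 + l. The main term on the right is 2 t1
  (t2 - t1) <= 2 sqrt x1 (t2 - t1), whence sqrt x1 (t2 - t1) = O(l), and this is the claimed bound
  for t2^2 - t1^2. The error arises because f(u) no longer has mean 0. It is governed by the mean of
  the positive part of u - t1, which is exponentially small in x1. Since the average estimate is for
  C^1 functions, the kinks of f are smoothed at a scale that tends to 0.\<close>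

definition circ :: "real measure" where
  "circ = restrict_space lborel {0..2*pi}"

definition rad :: "real measure" where
  "rad = restrict_space lborel {0..1}"

text \<open>The Jacobian is not part of this measure: it appears as the factor \<open>fst x\<close>
  in the integrands. Continuous integrands are then integrable on a product of two compact
  intervals, and Fubini applies without weights.\<close>

abbreviation polar :: "(real \<times> real) measure" where
  "polar \<equiv> rad \<Otimes>\<^sub>M circ"

lemma space_circ [simp]: "space circ = {0..2*pi}"
  and space_rad [simp]: "space rad = {0..1}"
  by (simp_all add: circ_def rad_def space_restrict_space)

lemma emeasure_circ: "emeasure circ (space circ) = ennreal (2*pi)"
  and emeasure_rad: "emeasure rad (space rad) = 1"
  by (simp_all add: circ_def rad_def space_restrict_space emeasure_restrict_space)

interpretation circ: finite_measure circ
  by standard (simp add: emeasure_circ del: space_circ)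

interpretation rad: finite_measure rad
  by standard (simp add: emeasure_rad del: space_rad)

interpretation polar: pair_sigma_finite rad circ ..

interpretation polar: finite_measure polar
  by (rule finite_measure_pair_measure) unfold_locales

lemma measure_circ: "measure circ {0..2*pi} = 2*pi"
  using emeasure_circ by (simp add: measure_def)

lemma measurable_circ [measurable (raw)]: "f \<in> borel_measurable borel \<Longrightarrow> f \<in> borel_measurable circ"
  and measurable_rad [measurable (raw)]: "f \<in> borel_measurable borel \<Longrightarrow> f \<in> borel_measurable rad"
  by (auto simp: circ_def rad_def intro!: measurable_restrict_space1)

lemma measurable_polar:
  fixes f :: "real \<times> real \<Rightarrow> 'b::topological_space"
  assumes "f \<in> borel_measurable borel"
  shows "f \<in> borel_measurable polar"
proof -
  have "(\<lambda>x::real. x) \<in> borel_measurable rad" "(\<lambda>x::real. x) \<in> borel_measurable circ"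
    by measurable
  from measurable_compose[OF measurable_fst this(1)] measurable_compose[OF measurable_snd this(2)]
  have "(\<lambda>x. (fst x, snd x)) \<in> borel_measurable polar"
    unfolding borel_prod[symmetric] by (rule measurable_Pair)
  from measurable_compose[OF this assms] show ?thesis
    by simp
qed

lemma integrable_circ:
  fixes f :: "real \<Rightarrow> 'b::{banach, second_countable_topology}"
  assumes "continuous_on UNIV f"
  shows "integrable circ f"
proof -
  have f: "f \<in> borel_measurable borel"
    using assms by (rule borel_measurable_continuous_onI)
  have "bounded (f ` {0..2*pi})"
    by (intro compact_imp_bounded compact_continuous_image continuous_on_subset[OF assms]) auto
  then obtain B where "\<forall>x\<in>{0..2*pi}. norm (f x) \<le> B"
    unfolding bounded_iff by auto
  with f show ?thesis
    by (intro circ.integrable_const_bound[of _ B] AE_I2) (auto intro: measurable_circ)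
qed

lemma integrable_rad:
  fixes f :: "real \<Rightarrow> 'b::{banach, second_countable_topology}"
  assumes "continuous_on UNIV f"
  shows "integrable rad f"
proof -
  have f: "f \<in> borel_measurable borel"
    using assms by (rule borel_measurable_continuous_onI)
  have "bounded (f ` {0..1})"
    by (intro compact_imp_bounded compact_continuous_image continuous_on_subset[OF assms]) auto
  then obtain B where "\<forall>x\<in>{0..1}. norm (f x) \<le> B"
    unfolding bounded_iff by auto
  with f show ?thesis
    by (intro rad.integrable_const_bound[of _ B] AE_I2) (auto intro: measurable_rad)
qed

lemma integrable_polar:
  fixes f :: "real \<times> real \<Rightarrow> 'b::{banach, second_countable_topology}"
  assumes "continuous_on UNIV f"
  shows "integrable polar f"
proof -
  have f: "f \<in> borel_measurable borel"
    using assms by (rule borel_measurable_continuous_onI)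
  have "bounded (f ` ({0..1} \<times> {0..2*pi}))"
    by (intro compact_imp_bounded compact_continuous_image continuous_on_subset[OF assms] compact_Times) auto
  then obtain B where "\<forall>x\<in>{0..1} \<times> {0..2*pi}. norm (f x) \<le> B"
    unfolding bounded_iff by blast
  with f show ?thesis
    by (intro polar.integrable_const_bound[of _ B] AE_I2)
       (auto intro: measurable_polar simp: space_pair_measure)
qed

lemma integral_circ_FTC:
  fixes F f :: "real \<Rightarrow> 'a::euclidean_space"
  assumes "\<And>x. (F has_vector_derivative f x) (at x)" "continuous_on UNIV f"
  shows "(LINT x|circ. f x) = F (2*pi) - F 0"
  unfolding circ_def
  by (subst integral_restrict_space)
     (auto intro!: integral_FTC_atLeastAtMost has_vector_derivative_at_within assms
       continuous_on_subset[OF assms(2)])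

lemma integral_rad_FTC:
  fixes F f :: "real \<Rightarrow> 'a::euclidean_space"
  assumes "\<And>x. (F has_vector_derivative f x) (at x)" "continuous_on UNIV f"
  shows "(LINT x|rad. f x) = F 1 - F 0"
  unfolding rad_def
  by (subst integral_restrict_space)
     (auto intro!: integral_FTC_atLeastAtMost has_vector_derivative_at_within assms
       continuous_on_subset[OF assms(2)])

lemma integral_polar_fst:
  fixes f :: "real \<times> real \<Rightarrow> 'b::{banach, second_countable_topology}"
  assumes "continuous_on UNIV f"
  shows "integral\<^sup>L polar f = (LINT r|rad. LINT t|circ. f (r, t))"
  using polar.integral_fst'[OF integrable_polar[OF assms]] by simp

lemma integral_polar_snd:
  fixes f :: "real \<times> real \<Rightarrow> 'b::{banach, second_countable_topology}"
  assumes "continuous_on UNIV f"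
  shows "integral\<^sup>L polar f = (LINT t|circ. LINT r|rad. f (r, t))"
  using polar.integral_snd[of "\<lambda>r t. f (r, t)"] integrable_polar[OF assms] by simp

section \<open>Divergence theorem in polar coordinates\<close>

lemma has_vector_derivative_rcis:
  shows "((\<lambda>r. rcis r t) has_vector_derivative cis t) (at r)"
    and "((\<lambda>t. rcis r t) has_vector_derivative \<i> * rcis r t) (at t)"
    and "((\<lambda>t. cis t) has_vector_derivative \<i> * cis t) (at t)"
  by (auto simp: rcis_def has_vector_derivative_def complex_eq_iff fun_eq_iff cis.code Complex_eq
      algebra_simps intro!: derivative_eq_intros)

lemma continuous_on_rcis [continuous_intros]:
  assumes "continuous_on S f" "continuous_on S g"
  shows "continuous_on S (\<lambda>x. rcis (f x) (g x))"
  unfolding rcis_def using assms by (intro continuous_intros) auto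

text \<open>The integrand is the divergence in \<open>(r, t)\<close> of
  \<open>(w Re (z p), w Re (\<i> e\<^sup>i\<^sup>t p))\<close>, since \<open>p\<close> is holomorphic.\<close>

lemma polar_pairing:
  fixes w :: "complex \<Rightarrow> real" and G p p' :: "complex \<Rightarrow> complex"
  assumes w: "\<And>z. (w has_derivative (\<lambda>h. G z \<bullet> h)) (at z)" and G: "continuous_on UNIV G"
    and p: "\<And>z. (p has_field_derivative p' z) (at z)" and p': "continuous_on UNIV p'"
  shows "(LINT x|polar. fst x * Re (G (rcis (fst x) (snd x)) * p (rcis (fst x) (snd x))))
    = (LINT t|circ. w (cis t) * Re (cis t * p (cis t)))"
proof -
  define X where "X = (\<lambda>r t. w (rcis r t) * Re (rcis r t * p (rcis r t)))"
  define Y where "Y = (\<lambda>r t. w (rcis r t) * Re (\<i> * cis t * p (rcis r t)))"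
  define X' where "X' = (\<lambda>x. case x of (r, t) \<Rightarrow>
    w (rcis r t) * Re (cis t * p (rcis r t) + rcis r t * (cis t * p' (rcis r t)))
      + (G (rcis r t) \<bullet> cis t) * Re (rcis r t * p (rcis r t)))"
  define Y' where "Y' = (\<lambda>x. case x of (r, t) \<Rightarrow>
    w (rcis r t) * Re (\<i> * (\<i> * cis t) * p (rcis r t) + \<i> * cis t * (\<i> * rcis r t * p' (rcis r t)))
      + (G (rcis r t) \<bullet> (\<i> * rcis r t)) * Re (\<i> * cis t * p (rcis r t)))"
  have cw: "continuous_on UNIV w"
    by (meson w has_derivative_continuous continuous_at_imp_continuous_on)
  have cp: "continuous_on UNIV p"
    by (meson p DERIV_isCont continuous_at_imp_continuous_on)
  note cont = continuous_on_compose2[OF cw] continuous_on_compose2[OF cp]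
    continuous_on_compose2[OF G] continuous_on_compose2[OF p']
  have cX': "continuous_on UNIV X'" and cY': "continuous_on UNIV Y'"
    unfolding X'_def Y'_def case_prod_beta by (auto intro!: continuous_intros cont)
  have dw: "((\<lambda>s. w (f s)) has_vector_derivative (G (f s) \<bullet> f')) (at s)"
    if "(f has_vector_derivative f') (at s)" for f f' s
    using has_derivative_compose[OF that[unfolded has_vector_derivative_def] w]
    by (simp add: has_vector_derivative_def)
  have dp: "((\<lambda>s. p (f s)) has_vector_derivative (f' * p' (f s))) (at s)"
    if "(f has_vector_derivative f') (at s)" for f f' s
    using field_vector_diff_chain_at[OF that p] by (simp add: o_def)
  have dRe: "((\<lambda>s. Re (f s)) has_vector_derivative Re f') (at s)"
    if "(f has_vector_derivative f') (at s)" for f f' and s :: real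
    using that by (rule bounded_linear.has_vector_derivative[OF bounded_linear_Re])
  note dm = has_vector_derivative_mult[THEN has_vector_derivative_eq_rhs]
  have dX: "((\<lambda>r. X r t) has_vector_derivative X' (r, t)) (at r)" for r t
    unfolding X_def X'_def
    by (rule refl dm dw dRe dp has_vector_derivative_rcis | simp only: prod.case add_ac)+
  have dY: "((\<lambda>t. Y r t) has_vector_derivative Y' (r, t)) (at t)" for r t
    unfolding Y_def Y'_def
    by (rule refl dm dw dRe dp has_vector_derivative_rcis has_vector_derivative_const | simp add: add_ac)+
  have "fst x * Re (G (rcis (fst x) (snd x)) * p (rcis (fst x) (snd x))) = X' x + Y' x" for x
  proof -
    obtain r t where x: "x = (r, t)" by force
    \<comment> \<open>In real coordinates: \<open>V\<close> is the value of \<open>w\<close>,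
      \<open>C\<close> and \<open>S\<close> are cosine and sine, and \<open>a + ib\<close>,
      \<open>c + id\<close>, \<open>e + if\<close> are the values of \<open>G\<close>,
      \<open>p\<close>, \<open>p'\<close>. All terms with \<open>V\<close> cancel; this is the
      Cauchy-Riemann equation for \<open>p\<close>.\<close>
    have *: "V * (C * c - S * d + (r * C * (C * e - S * f) - r * S * (C * f + S * e)))
        + (a * C + b * S) * (r * C * c - r * S * d)
        + (V * (- (S * (- (r * S * e) - r * C * f)) - C * (r * C * e - r * S * f) - (C * c - S * d))
        + (b * (r * C) - a * (r * S)) * (- (S * c) - C * d))
        = r * (a * c - b * d) * (C * C + S * S)" for V C S a b c d e f :: real
      by (simp add: algebra_simps)
    have 1: "cos t * cos t + sin t * sin t = 1"
      using sin_cos_squared_add[of t] by (simp add: power2_eq_square)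
    obtain a b c d where "G (rcis r t) = Complex a b" "p (rcis r t) = Complex c d"
      by (meson complex.exhaust)
    then show ?thesis
      unfolding x X'_def Y'_def
      by (simp add: rcis_def inner_complex_def * 1)
  qed
  then have "(LINT x|polar. fst x * Re (G (rcis (fst x) (snd x)) * p (rcis (fst x) (snd x))))
    = (LINT x|polar. X' x) + (LINT x|polar. Y' x)"
    using integrable_polar[OF cX'] integrable_polar[OF cY'] by simp
  \<comment> \<open>The factor \<open>rcis r t\<close> makes \<open>X 0 t\<close> vanish, so the
    origin contributes no boundary term and only the unit circle remains.\<close>
  also have "(LINT x|polar. X' x) = (LINT t|circ. X 1 t)"
  proof -
    have "(LINT r|rad. X' (r, t)) = X 1 t - X 0 t" for t
      by (rule integral_rad_FTC[OF dX])
         (auto intro!: continuous_on_compose2[OF cX'] continuous_intros)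
    then show ?thesis
      unfolding integral_polar_snd[OF cX'] by (simp add: X_def)
  qed
  also have "(LINT x|polar. Y' x) = 0"
  proof -
    have "(LINT t|circ. Y' (r, t)) = Y r (2*pi) - Y r 0" for r
      by (rule integral_circ_FTC[OF dY])
         (auto intro!: continuous_on_compose2[OF cY'] continuous_intros)
    then show ?thesis
      unfolding integral_polar_fst[OF cY'] by (simp add: Y_def rcis_def cis.code)
  qed
  finally show ?thesis by (simp add: X_def rcis_def)
qed

section \<open>Finite Fourier sums\<close>

lemma integral_Cauchy_Schwarz:
  fixes f g :: "'a \<Rightarrow> real"
  assumes f: "integrable M (\<lambda>x. (f x)\<^sup>2)" and g: "integrable M (\<lambda>x. (g x)\<^sup>2)"
    and fg: "integrable M (\<lambda>x. f x * g x)"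
  shows "\<bar>LINT x|M. f x * g x\<bar> \<le> sqrt (LINT x|M. (f x)\<^sup>2) * sqrt (LINT x|M. (g x)\<^sup>2)"
proof -
  define A B C where "A = (LINT x|M. (f x)\<^sup>2)" and "B = (LINT x|M. (g x)\<^sup>2)"
    and "C = (LINT x|M. f x * g x)"
  have quad: "0 \<le> A * s\<^sup>2 - 2 * C * s + B" for s
  proof -
    have "0 \<le> (LINT x|M. (f x * s - g x)\<^sup>2)"
      by simp
    also have "\<dots> = (LINT x|M. (f x)\<^sup>2 * s\<^sup>2 - f x * g x * (2 * s) + (g x)\<^sup>2)"
      by (simp add: power2_eq_square algebra_simps)
    also have "\<dots> = A * s\<^sup>2 - C * (2 * s) + B"
      unfolding A_def B_def C_def using f g fg by simp
    finally show ?thesis by (simp add: algebra_simps)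
  qed
  have AB: "0 \<le> A" "0 \<le> B"
    unfolding A_def B_def by simp_all
  have "C\<^sup>2 \<le> A * B"
  proof (cases "A = 0")
    case True
    \<comment> \<open>For \<open>A = 0\<close> the quadratic is affine in \<open>s\<close>, and the
      value of \<open>s\<close> chosen below would make it equal to -1.\<close>
    have "C = 0"
    proof (rule ccontr)
      assume "C \<noteq> 0"
      then show False
        using quad[of "(B + 1) / (2 * C)"] True by simp
    qed
    then show ?thesis using True by simp
  next
    case False
    then have "A > 0" using AB by simp
    then show ?thesis
      using quad[of "C / A"] by (simp add: field_simps power2_eq_square)
  qed
  then have "\<bar>C\<bar> \<le> sqrt (A * B)"
    by (simp add: real_le_rsqrt)
  then show ?thesis
    unfolding A_def B_def C_def by (simp add: real_sqrt_mult)
qed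

lemma integral_cis_power:
  "(LINT t|circ. cis t ^ m * cnj (cis t ^ n)) = (if m = n then of_real (2 * pi) else 0)"
proof -
  define k where "k = real m - real n"
  have eq: "cis t ^ m * cnj (cis t ^ n) = cis (k * t)" for t
    unfolding k_def by (simp add: Complex.DeMoivre cis_cnj cis_mult left_diff_distrib)
  show ?thesis
  proof (cases "m = n")
    case True
    then show ?thesis
      unfolding eq by (simp add: k_def measure_circ scaleR_conv_of_real)
  next
    case False
    then have k: "k \<noteq> 0" by (simp add: k_def)
    have d: "((\<lambda>t. cis (k * t) / (\<i> * of_real k)) has_vector_derivative cis (k * t)) (at t)" for t
      using k by (auto simp: has_vector_derivative_def complex_eq_iff fun_eq_iff cis.code Complex_eq
        field_simps intro!: derivative_eq_intros)
    have "(LINT t|circ. cis (k * t)) = cis (k * (2*pi)) / (\<i> * of_real k) - cis (k * 0) / (\<i> * of_real k)"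
      by (rule integral_circ_FTC[OF d]) (auto intro!: continuous_intros)
    also have "cis (k * (2*pi)) = cis (2 * pi * of_int (int m - int n))"
      by (simp add: k_def algebra_simps)
    also have "\<dots> = 1"
      by (rule cis_multiple_2pi) simp
    finally show ?thesis
      unfolding eq using False by simp
  qed
qed

lemma integral_trig_poly_mult_cnj:
  "(LINT t|circ. (\<Sum>n<N. a n * cis t ^ n) * cnj (\<Sum>n<N. b n * cis t ^ n))
    = of_real (2 * pi) * (\<Sum>n<N. a n * cnj (b n))"
proof -
  have "(LINT t|circ. (\<Sum>n<N. a n * cis t ^ n) * cnj (\<Sum>n<N. b n * cis t ^ n))
    = (LINT t|circ. (\<Sum>m<N. \<Sum>n<N. a m * cnj (b n) * (cis t ^ m * cnj (cis t ^ n))))"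
    by (simp add: sum_product mult_ac)
  also have "\<dots> = (\<Sum>m<N. \<Sum>n<N. a m * cnj (b n) * (LINT t|circ. cis t ^ m * cnj (cis t ^ n)))"
    by (subst Bochner_Integration.integral_sum integral_mult_right_zero |
        intro integrable_circ continuous_intros sum.cong refl | simp)+
  also have "\<dots> = of_real (2 * pi) * (\<Sum>n<N. a n * cnj (b n))"
    unfolding integral_cis_power by (simp add: sum_distrib_left if_distrib cong: if_cong)
       (simp add: mult_ac)
  finally show ?thesis .
qed

lemma integral_trig_poly_sq:
  "(LINT t|circ. (norm (\<Sum>n<N. a n * cis t ^ n))\<^sup>2) = 2 * pi * (\<Sum>n<N. (norm (a n))\<^sup>2)"
proof -
  have "of_real (LINT t|circ. (norm (\<Sum>n<N. a n * cis t ^ n))\<^sup>2)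
    = (LINT t|circ. complex_of_real ((norm (\<Sum>n<N. a n * cis t ^ n))\<^sup>2))"
    by (simp del: of_real_power)
  also have "\<dots> = of_real (2 * pi) * (\<Sum>n<N. a n * cnj (a n))"
    unfolding complex_norm_square by (rule integral_trig_poly_mult_cnj)
  also have "\<dots> = of_real (2 * pi * (\<Sum>n<N. (norm (a n))\<^sup>2))"
    by (simp add: complex_norm_square del: of_real_power)
  finally show ?thesis
    using of_real_eq_iff by blast
qed

text \<open>This is the Dirichlet energy of the real part of a primitive of the polynomial.
  Orthogonality in the angle removes the mixed terms, and the radial integral of r^(2n+1) produces
  the weight 1/(n+1) that later sums to a logarithm.\<close>

lemma polar_integral_poly_sq:
  "(LINT x|polar. fst x * (norm (\<Sum>n<N. c n * rcis (fst x) (snd x) ^ n))\<^sup>2)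
    = pi * (\<Sum>n<N. (norm (c n))\<^sup>2 / real (n + 1))"
proof -
  have r: "(LINT r|rad. r * (r ^ n)\<^sup>2) = 1 / (2 * real (n + 1))" for n
  proof -
    have "((\<lambda>r. r ^ (2 * n + 2) / (2 * real (n + 1))) has_vector_derivative r * (r ^ n)\<^sup>2) (at r)" for r :: real
    proof -
      have "((\<lambda>r. r ^ (2 * n + 2)) has_real_derivative real (2 * n + 2) * r ^ (2 * n + 1)) (at r)"
        using DERIV_pow[of "2 * n + 2" r] by simp
      from DERIV_cdivide[OF this, of "2 * real (n + 1)"]
      show ?thesis
        unfolding has_real_derivative_iff_has_vector_derivative[symmetric]
        by (rule DERIV_cong) (simp add: power_mult field_simps)
    qed
    from integral_rad_FTC[OF this] show ?thesis
      by (simp add: continuous_intros)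
  qed
  have t: "(LINT t|circ. r * (norm (\<Sum>n<N. c n * rcis r t ^ n))\<^sup>2)
      = (\<Sum>n<N. 2 * pi * (norm (c n))\<^sup>2 * (r * (r ^ n)\<^sup>2))" for r
  proof -
    have "(LINT t|circ. r * (norm (\<Sum>n<N. c n * rcis r t ^ n))\<^sup>2)
      = r * (LINT t|circ. (norm (\<Sum>n<N. (c n * of_real r ^ n) * cis t ^ n))\<^sup>2)"
      by (simp add: rcis_def power_mult_distrib mult_ac)
    moreover have *: "(\<bar>r\<bar> ^ n)\<^sup>2 = (r ^ n)\<^sup>2" for n
      by (metis power_abs power2_abs)
    ultimately show ?thesis
      unfolding integral_trig_poly_sq
      by (simp add: norm_mult norm_power power_mult_distrib sum_distrib_left mult_ac *)
  qed
  have "(LINT x|polar. fst x * (norm (\<Sum>n<N. c n * rcis (fst x) (snd x) ^ n))\<^sup>2)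
     = (LINT r|rad. (\<Sum>n<N. 2 * pi * (norm (c n))\<^sup>2 * (r * (r ^ n)\<^sup>2)))"
    by (subst integral_polar_fst) (simp_all only: fst_conv snd_conv t, intro continuous_intros)
  also have "\<dots> = (\<Sum>n<N. 2 * pi * (norm (c n))\<^sup>2 * (1 / (2 * real (n + 1))))"
    by (subst Bochner_Integration.integral_sum) (auto simp: r intro!: integrable_rad continuous_intros)
  also have "\<dots> = pi * (\<Sum>n<N. (norm (c n))\<^sup>2 / real (n + 1))"
    unfolding sum_distrib_left by (intro sum.cong refl) (simp add: field_simps)
  finally show ?thesis .
qed

text \<open>\<open>S\<close> is the projection of \<open>q\<close> onto the frequencies below
  \<open>N\<close>. Its squared norm and its pairing with \<open>q\<close> both equal
  \<open>K\<close>, so expanding the squared distance from \<open>q\<close> to \<open>S\<close>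
  leaves the norm of \<open>q\<close> minus \<open>K\<close>. As \<open>m n\<close> is 2 pi times a
  conjugated Fourier coefficient, a factor 2 pi remains.\<close>

lemma bessel_circ:
  fixes q :: "real \<Rightarrow> real"
  assumes q: "q \<in> borel_measurable borel" and B: "\<And>t. \<bar>q t\<bar> \<le> B"
  defines "m \<equiv> \<lambda>n. LINT t|circ. of_real (q t) * cis t ^ n"
  shows "(\<Sum>n<N. (norm (m n))\<^sup>2) \<le> 2 * pi * (LINT t|circ. (q t)\<^sup>2)"
proof -
  define S where "S = (\<lambda>t. \<Sum>n<N. (cnj (m n) / of_real (2*pi)) * cis t ^ n)"
  define K where "K = (\<Sum>n<N. (norm (m n))\<^sup>2) / (2 * pi)"
  have q2: "integrable circ (\<lambda>t. (q t)\<^sup>2)"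
    using q B by (intro circ.integrable_const_bound[of _ "B\<^sup>2"] AE_I2)
      (auto simp: abs_le_square_iff[symmetric] intro!: measurable_circ intro: order_trans[OF B])
  have qc: "integrable circ (\<lambda>t. of_real (q t) * cis t ^ n)" for n
  proof -
    have [measurable]: "(\<lambda>t. cis t ^ n) \<in> borel_measurable borel"
      by (intro borel_measurable_continuous_onI continuous_intros)
    note [measurable] = q
    have "(\<lambda>t. of_real (q t) * cis t ^ n) \<in> borel_measurable borel"
      by measurable
    then show ?thesis
      using B by (intro circ.integrable_const_bound[of _ "B"] AE_I2 measurable_circ)
        (auto simp: norm_mult norm_power)
  qed
  have qS: "integrable circ (\<lambda>t. of_real (q t) * S t)"
    unfolding S_def sum_distrib_left
    using qc by (auto simp: mult.left_commute[of "of_real (q _)"] intro!: Bochner_Integration.integrable_sum)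
  have "(LINT t|circ. of_real (q t) * S t) = (\<Sum>n<N. cnj (m n) / of_real (2*pi) * m n)"
    unfolding S_def sum_distrib_left m_def
    using qc by (subst Bochner_Integration.integral_sum) (auto simp: mult.left_commute[of "of_real (q _)"])
  also have "\<dots> = of_real K"
    unfolding K_def by (simp add: sum_divide_distrib complex_norm_square mult.commute del: of_real_power)
  finally have 1: "(LINT t|circ. Re (of_real (q t) * S t)) = K"
    using integral_Re[OF qS] by (simp only: Re_complex_of_real)
  have "(LINT t|circ. (norm (S t))\<^sup>2) = 2 * pi * (\<Sum>n<N. (norm (m n))\<^sup>2 / (2 * pi)\<^sup>2)"
    unfolding S_def integral_trig_poly_sq by (simp add: norm_divide power_divide norm_mult)
  also have "\<dots> = K"
    unfolding K_def by (simp add: sum_divide_distrib[symmetric] power2_eq_square)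
  finally have 2: "(LINT t|circ. (norm (S t))\<^sup>2) = K" .
  have S2: "integrable circ (\<lambda>t. (norm (S t))\<^sup>2)"
    unfolding S_def by (intro integrable_circ continuous_intros)
  have "0 \<le> (LINT t|circ. (norm (of_real (q t) - S t))\<^sup>2)"
    by simp
  also have "\<dots> = (LINT t|circ. (q t)\<^sup>2 - 2 * Re (of_real (q t) * S t) + (norm (S t))\<^sup>2)"
    by (simp only: cmod_power2) (simp add: power2_eq_square algebra_simps)
  also have "\<dots> = (LINT t|circ. (q t)\<^sup>2) - 2 * K + K"
  proof -
    have i: "integrable circ (\<lambda>t. 2 * Re (of_real (q t) * S t))"
      using integrable_Re[OF qS] by (rule integrable_mult_right)
    have "(LINT t|circ. (q t)\<^sup>2 - 2 * Re (of_real (q t) * S t) + (norm (S t))\<^sup>2)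
      = (LINT t|circ. (q t)\<^sup>2) - (LINT t|circ. 2 * Re (of_real (q t) * S t)) + (LINT t|circ. (norm (S t))\<^sup>2)"
      using Bochner_Integration.integral_add[OF Bochner_Integration.integrable_diff[OF q2 i] S2]
        Bochner_Integration.integral_diff[OF q2 i] by (simp only:)
    also have "(LINT t|circ. 2 * Re (of_real (q t) * S t)) = 2 * K"
      by (simp only: integral_mult_right_zero 1)
    finally show ?thesis by (simp only: 2)
  qed
  finally show ?thesis
    unfolding K_def by (simp add: field_simps)
qed

text \<open>Since \<open>z * cnj z = 1\<close> on the circle, the product of the two nonconstant
  parts loses one power of \<open>z\<close> and of \<open>cnj z\<close>, which drives the induction.
  A leftover term in \<open>cnj z\<close> alone has the same real part as its conjugate, a
  polynomial in \<open>z\<close>.\<close>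

lemma Re_poly_mult_cnj_on_circle:
  "\<exists>r. \<forall>z. norm z = 1 \<longrightarrow> Re (poly p z * cnj (poly q z)) = Re (poly r z)"
proof (induction p arbitrary: q rule: pCons_induct)
  case 0
  show ?case by (intro exI[of _ 0]) simp
next
  case (pCons a p)
  obtain b q' where q: "q = pCons b q'" by (cases q)
  obtain r where r: "Re (poly p z * cnj (poly q' z)) = Re (poly r z)" if "norm z = 1" for z
    using pCons.IH by blast
  show ?case
  proof (intro exI[of _ "smult (cnj a) q + pCons 0 (smult (cnj b) p) + r"] allI impI)
    fix z :: complex assume z: "norm z = 1"
    then have "z * cnj z = 1"
      using complex_norm_square[of z] by simp
    then have "z * poly p z * cnj (poly q z) = cnj b * (z * poly p z) + poly p z * cnj (poly q' z)"
      unfolding q by (simp add: algebra_simps)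
    then have "Re (poly (pCons a p) z * cnj (poly q z))
      = Re (a * cnj (poly q z)) + Re (cnj b * (z * poly p z)) + Re (poly r z)"
      using r[OF z] by (simp add: distrib_right)
    then show "Re (poly (pCons a p) z * cnj (poly q z))
      = Re (poly (smult (cnj a) q + pCons 0 (smult (cnj b) p) + r) z)"
      by (simp add: algebra_simps)
  qed
qed

text \<open>Stone-Weierstrass yields polynomials in the two real coordinates, whereas the Fourier
  pairing is computed for real parts of complex polynomials. On the circle the latter are closed
  under products, because Re a Re b is half the sum of Re (a b) and Re (a cnj b).\<close>

lemma real_polynomial_on_circle:
  fixes g :: "complex \<Rightarrow> real"
  assumes "real_polynomial_function g"
  shows "\<exists>p. \<forall>z. norm z = 1 \<longrightarrow> g z = Re (poly p z)"
  using assms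
proof induction
  case (linear f)
  then interpret f: bounded_linear f .
  have "f z = Re (poly [:0, Complex (f 1) (- f \<i>):] z)" for z
  proof -
    have "f z = f (Re z *\<^sub>R 1 + Im z *\<^sub>R \<i>)"
      by (rule arg_cong) (simp add: complex_eq_iff)
    then show ?thesis
      by (simp add: f.add f.scaleR mult.commute)
  qed
  then show ?case by blast
next
  case (const c)
  show ?case by (intro exI[of _ "[:of_real c:]"]) simp
next
  case (add f g)
  then obtain p q where "\<forall>z. norm z = 1 \<longrightarrow> f z = Re (poly p z)" "\<forall>z. norm z = 1 \<longrightarrow> g z = Re (poly q z)"
    by blast
  then show ?case by (intro exI[of _ "p + q"]) simp
next
  case (mult f g)
  then obtain p q where pq: "\<forall>z. norm z = 1 \<longrightarrow> f z = Re (poly p z)" "\<forall>z. norm z = 1 \<longrightarrow> g z = Re (poly q z)"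
    by blast
  obtain r where r: "\<forall>z. norm z = 1 \<longrightarrow> Re (poly p z * cnj (poly q z)) = Re (poly r z)"
    using Re_poly_mult_cnj_on_circle by blast
  have "Re a * Re b = (Re (a * b) + Re (a * cnj b)) / 2" for a b
    by simp
  with pq r show ?case
    by (intro exI[of _ "smult (1/2) (p * q + r)"]) (simp del: times_complex.sel)
qed

section \<open>Averages over boundary sets\<close>

text \<open>The sum is cut at \<open>m\<close>, which is \<open>R\<close> rounded up. Below the cut,
  \<open>a n \<le> 1\<close> gives a harmonic sum, at most ln m + 1; beyond it the weight is at most
  1/m and the total mass \<open>R\<close> contributes at most 1. Replacing ln m by ln R costs
  another ln 2 <= 1, which makes the constant 3.\<close>

lemma sum_divide_Suc_le_ln:
  fixes a :: "nat \<Rightarrow> real"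
  assumes a: "\<And>n. 0 \<le> a n" "\<And>n. a n \<le> 1" and R: "1 \<le> R" and sum: "(\<Sum>n<N. a n) \<le> R"
  shows "(\<Sum>n<N. a n / real (n + 1)) \<le> ln R + 3"
proof -
  define m where "m = nat \<lceil>R\<rceil>"
  have m: "R \<le> real m" "real m \<le> R + 1" "m > 0"
    using R unfolding m_def by linarith+
  have le: "a n / real (n + 1) \<le> (if n < m then inverse (real (Suc n)) else 0) + a n / real m" for n
  proof (cases "n < m")
    case True
    have "a n / real (n + 1) \<le> inverse (real (Suc n))"
      using a(2)[of n] by (simp add: divide_simps)
    then show ?thesis using True a(1)[of n] by (simp add: add_increasing2)
  next
    case False
    then have "a n / real (n + 1) \<le> a n / real m"
      using a(1)[of n] m by (intro divide_left_mono) auto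
    then show ?thesis using False by simp
  qed
  have "(\<Sum>n<N. a n / real (n + 1)) \<le> (\<Sum>n<N. if n < m then inverse (real (Suc n)) else 0) + (\<Sum>n<N. a n) / real m"
    unfolding sum_divide_distrib sum.distrib[symmetric] by (intro sum_mono le)
  also have "(\<Sum>n<N. if n < m then inverse (real (Suc n)) else 0) \<le> harm m"
    unfolding harm_altdef sum.If_cases[OF finite_lessThan] by (auto intro!: sum_mono2)
  also have "harm m \<le> ln (real m) + 1"
    using euler_mascheroni_sequence_decreasing[of 1 m] m by (simp add: harm_expand)
  also have "ln (real m) \<le> ln (2 * R)"
    using m R by (intro ln_mono) auto
  also have "ln (2 * R) = ln 2 + ln R"
    using R by (simp add: ln_mult)
  also have "ln 2 \<le> (1::real)"
    using ln_le_minus_one[of "2::real"] by simp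
  also have "(\<Sum>n<N. a n) / real m \<le> 1"
    using sum m by (simp add: divide_simps)
  finally show ?thesis by simp
qed

definition C1_gradient :: "(complex \<Rightarrow> real) \<Rightarrow> (complex \<Rightarrow> complex) \<Rightarrow> bool" where
  "C1_gradient w G \<longleftrightarrow> (\<forall>z. (w has_derivative (\<lambda>h. G z \<bullet> h)) (at z)) \<and> continuous_on UNIV G"

definition energy :: "(complex \<Rightarrow> complex) \<Rightarrow> real" where
  "energy G = (LINT x|polar. fst x * (norm (G (rcis (fst x) (snd x))))\<^sup>2)"

lemma C1_gradient_continuous: "C1_gradient w G \<Longrightarrow> continuous_on UNIV w"
  unfolding C1_gradient_def
  by (meson has_derivative_continuous continuous_at_imp_continuous_on)

text \<open>Let P be a primitive of the polynomial p. The gradient of Re P is \<open>cnj p\<close>,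
  so Re (G p) is its inner product with \<open>G\<close>, and Re (cis t p) is the normal derivative
  of Re P on the circle. The claim is Green's formula followed by Cauchy-Schwarz.\<close>

lemma boundary_pairing_le:
  assumes w: "C1_gradient w G"
  shows "\<bar>LINT t|circ. w (cis t) * Re (cis t * (\<Sum>n<N. c n * cis t ^ n))\<bar>
    \<le> sqrt (energy G) * sqrt (pi * (\<Sum>n<N. (norm (c n))\<^sup>2 / real (n + 1)))"
proof -
  define p where "p = (\<lambda>z. \<Sum>n<N. c n * z ^ n)"
  define p' where "p' = (\<lambda>z. \<Sum>n<N. c n * (of_nat n * z ^ (n - 1)))"
  have p: "(p has_field_derivative p' z) (at z)" for z
    unfolding p_def p'_def by (auto intro!: derivative_eq_intros sum.cong)
  have G: "continuous_on UNIV G" and dw: "\<And>z. (w has_derivative (\<lambda>h. G z \<bullet> h)) (at z)"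
    using w by (auto simp: C1_gradient_def)
  have p': "continuous_on UNIV p'"
    unfolding p'_def by (intro continuous_intros)
  have cp: "continuous_on UNIV p"
    unfolding p_def by (intro continuous_intros)
  \<comment> \<open>The Jacobian is shared as a square root between the two factors, so that each
    square carries the full area element.\<close>
  define f where "f = (\<lambda>x. sqrt (fst x) * norm (G (rcis (fst x) (snd x))))"
  define g where "g = (\<lambda>x. sqrt (fst x) * norm (p (rcis (fst x) (snd x))))"
  have cont: "continuous_on UNIV f" "continuous_on UNIV g"
    unfolding f_def g_def
    by (intro continuous_intros continuous_on_compose2[OF G] continuous_on_compose2[OF cp]; simp)+
  have f2: "(LINT x|polar. (f x)\<^sup>2) = energy G"
    unfolding energy_def f_def
    by (intro Bochner_Integration.integral_cong refl) (auto simp: power_mult_distrib space_pair_measure)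
  have g2: "(LINT x|polar. (g x)\<^sup>2) = pi * (\<Sum>n<N. (norm (c n))\<^sup>2 / real (n + 1))"
    unfolding polar_integral_poly_sq[symmetric] g_def p_def
    by (intro Bochner_Integration.integral_cong refl) (auto simp: power_mult_distrib space_pair_measure)
  define h where "h = (\<lambda>x. fst x * Re (G (rcis (fst x) (snd x)) * p (rcis (fst x) (snd x))))"
  have ch: "continuous_on UNIV h"
    unfolding h_def
    by (intro continuous_intros continuous_on_compose2[OF G] continuous_on_compose2[OF cp]; simp)
  have le: "\<bar>h x\<bar> \<le> f x * g x" if "x \<in> space polar" for x
  proof -
    have r: "0 \<le> fst x"
      using that by (auto simp: space_pair_measure)
    have "\<bar>h x\<bar> = fst x * \<bar>Re (G (rcis (fst x) (snd x)) * p (rcis (fst x) (snd x)))\<bar>"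
      unfolding h_def using r by (simp add: abs_mult del: times_complex.sel)
    also have "\<dots> \<le> fst x * (norm (G (rcis (fst x) (snd x))) * norm (p (rcis (fst x) (snd x))))"
      using r unfolding norm_mult[symmetric] by (intro mult_left_mono abs_Re_le_cmod)
    also have "\<dots> = (sqrt (fst x) * sqrt (fst x)) * (norm (G (rcis (fst x) (snd x))) * norm (p (rcis (fst x) (snd x))))"
      using r by simp
    also have "\<dots> = f x * g x"
      unfolding f_def g_def by (simp only: mult_ac)
    finally show ?thesis .
  qed
  have "\<bar>LINT x|polar. h x\<bar> \<le> (LINT x|polar. \<bar>h x\<bar>)"
    by (rule integral_abs_bound)
  also have "\<dots> \<le> (LINT x|polar. f x * g x)"
    by (intro integral_mono integrable_polar continuous_intros cont ch le)
  also have "\<dots> \<le> sqrt (LINT x|polar. (f x)\<^sup>2) * sqrt (LINT x|polar. (g x)\<^sup>2)"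
    by (rule order_trans[OF abs_ge_self integral_Cauchy_Schwarz])
       (intro integrable_polar continuous_intros cont)+
  finally show ?thesis
    using polar_pairing[OF dw G p p']
    unfolding f2 g2 h_def[symmetric] by (simp only: p_def)
qed

text \<open>The function \<open>s N\<close> is the partial Fourier sum of
  \<open>q - 1 / (2 * pi)\<close>, and the energy estimate holds for each \<open>N\<close>. The
  limit is taken on the side of \<open>w\<close>: it is replaced uniformly by a trigonometric
  polynomial of some degree \<open>N\<close>, for which \<open>s N\<close> gives the exact pairing,
  with an error controlled by L^1 norms.\<close>

theorem average_minus_mean_le:
  assumes w: "C1_gradient w G" and E: "E \<in> sets borel" "E \<subseteq> {0..2*pi}" and pos: "0 < measure circ E"
  shows "(LINT t|circ. indicator E t * w (cis t)) / measure circ E - (LINT t|circ. w (cis t)) / (2 * pi)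
    \<le> sqrt (energy G / pi) * sqrt (ln (2 * pi / measure circ E) + 3)"
proof -
  define d where "d = measure circ E"
  define q where "q = (\<lambda>t. indicator E t / d :: real)"
  define m where "m = (\<lambda>n. LINT t|circ. of_real (q t) * cis t ^ n)"
  have d: "0 < d" using pos by (simp add: d_def)
  have Ec: "E \<in> sets circ"
    using E by (auto simp: circ_def sets_restrict_space)
  have d2pi: "d \<le> 2 * pi"
    using circ.bounded_measure[of E] unfolding d_def by (simp add: measure_circ)
  have qm: "q \<in> borel_measurable borel"
    unfolding q_def using E by measurable
  have qB: "\<bar>q t\<bar> \<le> 1 / d" for t
    unfolding q_def using d by (auto simp: indicator_def)
  have q0: "0 \<le> q t" for t
    unfolding q_def using d by auto
  have int_q: "integrable circ (\<lambda>t. q t * f t)" if "continuous_on UNIV f" for f :: "real \<Rightarrow> real"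
    using integrable_mult_indicator[OF Ec integrable_circ[OF that]]
    unfolding q_def by (simp add: mult.commute)
  have int_qc: "integrable circ (\<lambda>t. of_real (q t) * f t)" if "continuous_on UNIV f" for f :: "real \<Rightarrow> complex"
    using integrable_mult_indicator[OF Ec integrable_circ[OF that]]
    unfolding q_def by (simp add: scaleR_conv_of_real)
  have q_mean: "(LINT t|circ. q t) = 1"
    unfolding q_def using Ec d E(2) by (simp add: d_def Int_absorb2)
  have q_sq: "(LINT t|circ. (q t)\<^sup>2) = 1 / d"
  proof -
    have "(q t)\<^sup>2 = q t / d" for t
      unfolding q_def by (simp add: indicator_def power2_eq_square)
    then show ?thesis by (simp add: q_mean)
  qed
  have m1: "norm (m n) \<le> 1" for n
  proof -
    have "norm (m n) \<le> (LINT t|circ. norm (of_real (q t) * cis t ^ n))"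
      unfolding m_def by (rule integral_norm_bound)
    then show ?thesis
      using q0 by (simp add: norm_mult norm_power q_mean)
  qed
  have bessel: "(\<Sum>n<N. (norm (m (Suc n)))\<^sup>2) \<le> 2 * pi / d" for N
  proof -
    have "(\<Sum>n<N. (norm (m (Suc n)))\<^sup>2) \<le> (\<Sum>n<Suc N. (norm (m n))\<^sup>2)"
      unfolding sum.lessThan_Suc_shift by simp
    also have "\<dots> \<le> 2 * pi / d"
      using bessel_circ[OF qm qB, of "Suc N"] unfolding q_sq by (simp add: m_def)
    finally show ?thesis .
  qed
  define L where "L = ln (2 * pi / d) + 3"
  \<comment> \<open>The factor is 1/pi rather than 1/(2 pi) because the frequencies n + 1 and -(n +
    1) of the real function \<open>q\<close> are folded into one real part.\<close>
  define c where "c = (\<lambda>n. cnj (m (Suc n)) / of_real pi)"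
  have weighted: "(\<Sum>n<N. (norm (m (Suc n)))\<^sup>2 / real (n + 1)) \<le> L" for N
    unfolding L_def using m1 bessel d d2pi
    by (intro sum_divide_Suc_le_ln) (auto simp: power_le_one)
  define s where "s = (\<lambda>N t. Re (cis t * (\<Sum>n<N. c n * cis t ^ n)))"
  have cs: "continuous_on UNIV (s N)" for N
    unfolding s_def by (intro continuous_intros)
  have pairing: "(LINT t|circ. w (cis t) * s N t) \<le> sqrt (energy G / pi) * sqrt L" for N
  proof -
    have "pi * (\<Sum>n<N. (norm (c n))\<^sup>2 / real (n + 1)) = (\<Sum>n<N. (norm (m (Suc n)))\<^sup>2 / real (n + 1)) / pi"
      unfolding c_def sum_divide_distrib sum_distrib_left
      by (intro sum.cong refl) (simp add: norm_divide power_divide power2_eq_square[of pi])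
    also have "\<dots> \<le> L / pi"
      using weighted by (intro divide_right_mono) auto
    finally have "sqrt (energy G) * sqrt (pi * (\<Sum>n<N. (norm (c n))\<^sup>2 / real (n + 1))) \<le> sqrt (energy G) * sqrt (L / pi)"
      by (intro mult_left_mono) (auto simp: energy_def intro!: integral_nonneg_AE AE_I2 simp: space_pair_measure)
    then show ?thesis
      using boundary_pairing_le[OF w, where c = c and N = N] unfolding s_def by (simp add: real_sqrt_divide)
  qed
  have s_sq: "(LINT t|circ. (norm (\<Sum>n<N. c n * cis t ^ n))\<^sup>2) \<le> 4 / d" for N
  proof -
    have "2 * pi * (\<Sum>n<N. (norm (c n))\<^sup>2) = 2 / pi * (\<Sum>n<N. (norm (m (Suc n)))\<^sup>2)"
      unfolding c_def sum_distrib_left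
      by (intro sum.cong refl) (simp add: norm_divide power_divide power2_eq_square[of pi])
    also have "\<dots> \<le> 2 / pi * (2 * pi / d)"
      by (intro mult_left_mono bessel) simp
    finally show ?thesis
      unfolding integral_trig_poly_sq by simp
  qed
  \<comment> \<open>Uniformity in \<open>N\<close> is the point: \<open>N\<close> will be the degree
    of a Stone-Weierstrass approximant, over which there is no control. It comes from the L^2 bound
    via y <= 1 + y^2.\<close>
  have s_L1: "(LINT t|circ. \<bar>s N t\<bar>) \<le> 2 * pi + 4 / d" for N
  proof -
    have "\<bar>s N t\<bar> \<le> 1 + (norm (\<Sum>n<N. c n * cis t ^ n))\<^sup>2" for t
    proof -
      define y where "y = norm (\<Sum>n<N. c n * cis t ^ n)"
      have "\<bar>s N t\<bar> \<le> norm (cis t * (\<Sum>n<N. c n * cis t ^ n))"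
        unfolding s_def by (rule abs_Re_le_cmod)
      also have "\<dots> = y" by (simp add: norm_mult y_def)
      also have "y \<le> 1 + y\<^sup>2"
        using zero_le_power2[of "y - 1 / 2"] by (simp add: power2_diff power_divide)
      finally show ?thesis by (simp add: y_def)
    qed
    then have "(LINT t|circ. \<bar>s N t\<bar>) \<le> (LINT t|circ. 1 + (norm (\<Sum>n<N. c n * cis t ^ n))\<^sup>2)"
      by (intro integral_mono integrable_circ continuous_intros cs) auto
    also have "\<dots> = 2 * pi + (LINT t|circ. (norm (\<Sum>n<N. c n * cis t ^ n))\<^sup>2)"
      by (subst Bochner_Integration.integral_add)
         (simp_all add: measure_circ, intro integrable_circ continuous_intros)
    finally show ?thesis using s_sq[of N] by linarith
  qed
  have cw: "continuous_on UNIV (\<lambda>t. w (cis t))"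
    by (intro continuous_on_compose2[OF C1_gradient_continuous[OF w]] continuous_intros) auto
  \<comment> \<open>With B the analytic polynomial whose real part is \<open>s N\<close>, Re A Re B
    is half of Re (A B) + Re (A cnj B). Since B has no constant term, A B has only positive
    frequencies and integrates to 0; the other half is Parseval.\<close>
  have trig: "(LINT t|circ. Re (poly P (cis t)) * (q t - 1 / (2 * pi))) = (LINT t|circ. Re (poly P (cis t)) * s (degree P) t)" for P
  proof -
    define N where "N = degree P"
    define a where "a = coeff P"
    \<comment> \<open>The index shift matters: \<open>s N\<close> starts at frequency 1, and with
      \<open>N\<close> the degree of \<open>P\<close> the indices below \<open>Suc N\<close> reach
      every coefficient of \<open>P\<close>.\<close>
    define b where "b = (\<lambda>n. case n of 0 \<Rightarrow> 0 | Suc k \<Rightarrow> c k)"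
    define A where "A = (\<lambda>t. \<Sum>n<Suc N. a n * cis t ^ n)"
    define B where "B = (\<lambda>t. \<Sum>n<Suc N. b n * cis t ^ n)"
    have PA: "poly P (cis t) = A t" for t
      unfolding poly_altdef A_def N_def a_def by (simp add: lessThan_Suc_atMost)
    have sB: "s N t = Re (B t)" for t
      unfolding s_def B_def b_def sum.lessThan_Suc_shift by (simp add: sum_distrib_left mult_ac)
    have cA: "continuous_on UNIV A" and cB: "continuous_on UNIV B"
      unfolding A_def B_def by (intro continuous_intros)+
    have int_cis: "(LINT t|circ. cis t ^ n) = (if n = 0 then of_real (2 * pi) else 0)" for n
      using integral_cis_power[of n 0] by simp
    have m0: "m 0 = 1"
      unfolding m_def using q_mean by simp
    have "(LINT t|circ. of_real (q t) * A t) = (\<Sum>n<Suc N. a n * m n)"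
    proof -
      have "(LINT t|circ. of_real (q t) * A t) = (LINT t|circ. (\<Sum>n<Suc N. a n * (of_real (q t) * cis t ^ n)))"
        unfolding A_def sum_distrib_left by (simp only: mult_ac)
      also have "\<dots> = (\<Sum>n<Suc N. (LINT t|circ. a n * (of_real (q t) * cis t ^ n)))"
        by (intro Bochner_Integration.integral_sum integrable_mult_right int_qc continuous_intros)
      finally show ?thesis unfolding m_def by (simp only: integral_mult_right_zero)
    qed
    then have 1: "(LINT t|circ. of_real (q t) * A t) = a 0 + (\<Sum>n<N. a (Suc n) * m (Suc n))"
      unfolding sum.lessThan_Suc_shift by (simp add: m0)
    have "(LINT t|circ. A t) = (\<Sum>n<Suc N. a n * (LINT t|circ. cis t ^ n))"
      unfolding A_def
      by (subst Bochner_Integration.integral_sum) (auto intro!: integrable_circ continuous_intros)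
    then have 2: "(LINT t|circ. A t) = a 0 * of_real (2 * pi)"
      unfolding int_cis sum.lessThan_Suc_shift by simp
    have "(LINT t|circ. Re (A t) * (q t - 1 / (2 * pi)))
      = (LINT t|circ. Re (of_real (q t) * A t) - Re (A t) / (2 * pi))"
      by (simp add: algebra_simps)
    also have "\<dots> = (LINT t|circ. Re (of_real (q t) * A t)) - (LINT t|circ. Re (A t) / (2 * pi))"
      by (intro Bochner_Integration.integral_diff integrable_Re int_qc cA integrable_circ continuous_intros) simp
    also have "(LINT t|circ. Re (of_real (q t) * A t)) = Re (a 0 + (\<Sum>n<N. a (Suc n) * m (Suc n)))"
      unfolding 1[symmetric] by (rule integral_Re[OF int_qc[OF cA]])
    also have "(LINT t|circ. Re (A t) / (2 * pi)) = Re (a 0)"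
      using integral_Re[OF integrable_circ[OF cA]] unfolding 2 by simp
    finally have lhs: "(LINT t|circ. Re (A t) * (q t - 1 / (2 * pi))) = Re (\<Sum>n<N. a (Suc n) * m (Suc n))"
      by simp
    have "(LINT t|circ. A t * cnj (B t)) = of_real (2 * pi) * (\<Sum>n<N. a (Suc n) * cnj (c n))"
      unfolding A_def B_def integral_trig_poly_mult_cnj
      by (simp add: b_def sum.lessThan_Suc_shift del: sum.lessThan_Suc)
    also have "\<dots> = 2 * (\<Sum>n<N. a (Suc n) * m (Suc n))"
      unfolding c_def by (simp add: sum_distrib_left mult_ac)
    finally have 3: "(LINT t|circ. A t * cnj (B t)) = 2 * (\<Sum>n<N. a (Suc n) * m (Suc n))" .
    have "A t * B t = (\<Sum>i<Suc N. \<Sum>j<N. a i * c j * cis t ^ (i + Suc j))" for t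
    proof -
      have "B t = (\<Sum>j<N. c j * cis t ^ Suc j)"
        unfolding B_def sum.lessThan_Suc_shift by (simp add: b_def)
      then show ?thesis
        by (simp only: A_def sum_product power_add mult_ac)
    qed
    then have "(LINT t|circ. A t * B t) = (LINT t|circ. (\<Sum>i<Suc N. \<Sum>j<N. a i * c j * cis t ^ (i + Suc j)))"
      by (simp only:)
    also have "\<dots> = (\<Sum>i<Suc N. (LINT t|circ. (\<Sum>j<N. a i * c j * cis t ^ (i + Suc j))))"
      by (intro Bochner_Integration.integral_sum integrable_circ continuous_intros)
    also have "\<dots> = (\<Sum>i<Suc N. \<Sum>j<N. (LINT t|circ. a i * c j * cis t ^ (i + Suc j)))"
      by (intro sum.cong refl Bochner_Integration.integral_sum integrable_circ continuous_intros)
    also have "\<dots> = 0"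
      by (intro sum.neutral ballI) (simp only: integral_mult_right_zero int_cis, simp)
    finally have 4: "(LINT t|circ. A t * B t) = 0" .
    have "(LINT t|circ. Re (A t) * Re (B t)) = (LINT t|circ. (Re (A t * B t) + Re (A t * cnj (B t))) / 2)"
      by simp
    also have "\<dots> = ((LINT t|circ. Re (A t * B t)) + (LINT t|circ. Re (A t * cnj (B t)))) / 2"
      by (subst integral_divide_zero, subst Bochner_Integration.integral_add)
         (intro integrable_circ continuous_intros cA cB refl)+
    also have "(LINT t|circ. Re (A t * B t)) = Re (LINT t|circ. A t * B t)"
      by (intro integral_Re integrable_circ continuous_intros cA cB)
    also have "(LINT t|circ. Re (A t * cnj (B t))) = Re (LINT t|circ. A t * cnj (B t))"
      by (intro integral_Re integrable_circ continuous_intros cA cB)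
    finally show ?thesis
      unfolding 3 4 PA N_def[symmetric] sB lhs by simp
  qed
  \<comment> \<open>The sum of the L^1 bounds for \<open>q\<close>, for the constant 1/(2 pi), which
    contribute 1 each, and for \<open>s N\<close>.\<close>
  define K where "K = 2 + 2 * pi + 4 / d"
  have K: "K > 0" unfolding K_def using d by (simp add: add_pos_pos)
  have main: "(LINT t|circ. w (cis t) * (q t - 1 / (2 * pi))) \<le> sqrt (energy G / pi) * sqrt L + e" if e: "e > 0" for e
  proof -
    obtain g where g: "real_polynomial_function g" "\<And>z. z \<in> sphere 0 1 \<Longrightarrow> \<bar>w z - g z\<bar> < e / K"
      by (rule Stone_Weierstrass_real_polynomial_function[of "sphere 0 1" w "e / K"])
         (use K e C1_gradient_continuous[OF w] in \<open>auto intro: continuous_on_subset\<close>)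
    obtain P where P: "\<And>z. norm z = 1 \<Longrightarrow> g z = Re (poly P z)"
      using real_polynomial_on_circle[OF g(1)] by blast
    have approx: "\<bar>w (cis t) - Re (poly P (cis t))\<bar> \<le> e / K" for t
      using g(2)[of "cis t"] P[of "cis t"] by simp
    define N where "N = degree P"
    define v where "v = (\<lambda>t. w (cis t) - Re (poly P (cis t)))"
    have cP: "continuous_on UNIV (\<lambda>t. Re (poly P (cis t)))"
      by (intro continuous_intros)
    have cv: "continuous_on UNIV v"
      unfolding v_def by (intro continuous_intros cw)
    have i1: "integrable circ (\<lambda>t. f t * (q t - 1 / (2 * pi)))" if "continuous_on UNIV f" for f
      using Bochner_Integration.integrable_diff[OF int_q[OF that] integrable_mult_right[OF integrable_circ[OF that], of "1/(2*pi)"]]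
      by (simp add: algebra_simps)
    have i2: "integrable circ (\<lambda>t. f t * s N t)" if "continuous_on UNIV f" for f
      by (intro integrable_circ continuous_intros that cs)
    have "(LINT t|circ. w (cis t) * (q t - 1 / (2 * pi)))
       = (LINT t|circ. v t * (q t - 1 / (2 * pi)) + Re (poly P (cis t)) * (q t - 1 / (2 * pi)))"
      by (simp add: v_def algebra_simps)
    also have "\<dots> = (LINT t|circ. v t * (q t - 1 / (2 * pi))) + (LINT t|circ. Re (poly P (cis t)) * s N t)"
      using Bochner_Integration.integral_add[OF i1[OF cv] i1[OF cP]] unfolding trig N_def by simp
    also have "(LINT t|circ. Re (poly P (cis t)) * s N t) = (LINT t|circ. w (cis t) * s N t - v t * s N t)"
      by (simp add: v_def algebra_simps)
    also have "\<dots> = (LINT t|circ. w (cis t) * s N t) - (LINT t|circ. v t * s N t)"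
      by (rule Bochner_Integration.integral_diff[OF i2[OF cw] i2[OF cv]])
    also have "(LINT t|circ. v t * (q t - 1 / (2 * pi))) + ((LINT t|circ. w (cis t) * s N t) - (LINT t|circ. v t * s N t))
      = (LINT t|circ. w (cis t) * s N t) + (LINT t|circ. v t * (q t - 1 / (2 * pi)) - v t * s N t)"
      using Bochner_Integration.integral_diff[OF i1[OF cv] i2[OF cv]] by simp
    also have "(LINT t|circ. v t * (q t - 1 / (2 * pi)) - v t * s N t) \<le> (LINT t|circ. e / K * (q t + 1 / (2 * pi) + \<bar>s N t\<bar>))"
    proof (rule integral_mono)
      show "integrable circ (\<lambda>t. v t * (q t - 1 / (2 * pi)) - v t * s N t)"
        by (intro Bochner_Integration.integrable_diff i1 i2 cv)
      show "integrable circ (\<lambda>t. e / K * (q t + 1 / (2 * pi) + \<bar>s N t\<bar>))"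
        using int_q[of "\<lambda>_. 1"]
        by (intro integrable_mult_right Bochner_Integration.integrable_add)
           (simp, (intro integrable_circ continuous_intros cs)+)
      fix t
      have "v t * (q t - 1 / (2 * pi)) - v t * s N t \<le> \<bar>v t\<bar> * \<bar>q t - 1 / (2 * pi) - s N t\<bar>"
        unfolding abs_mult[symmetric] by (simp add: algebra_simps)
      also have "\<dots> \<le> e / K * (q t + 1 / (2 * pi) + \<bar>s N t\<bar>)"
      proof (intro mult_mono)
        have "\<bar>q t - 1 / (2 * pi) - s N t\<bar> \<le> \<bar>q t\<bar> + \<bar>1 / (2 * pi)\<bar> + \<bar>s N t\<bar>"
          by linarith
        then show "\<bar>q t - 1 / (2 * pi) - s N t\<bar> \<le> q t + 1 / (2 * pi) + \<bar>s N t\<bar>"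
          using q0[of t] by simp
      qed (use approx e K in \<open>auto simp: v_def\<close>)
      finally show "v t * (q t - 1 / (2 * pi)) - v t * s N t \<le> e / K * (q t + 1 / (2 * pi) + \<bar>s N t\<bar>)" .
    qed
    also have "\<dots> = e / K * (1 + 1 + (LINT t|circ. \<bar>s N t\<bar>))"
    proof -
      have "integrable circ q" using int_q[of "\<lambda>_. 1"] by simp
      moreover have "integrable circ (\<lambda>t. \<bar>s N t\<bar>)"
        by (intro integrable_circ continuous_intros cs)
      ultimately show ?thesis
        by (simp add: q_mean measure_circ)
    qed
    also have "\<dots> \<le> e / K * K"
      using s_L1[of N] e K unfolding K_def by (intro mult_left_mono) auto
    also have "\<dots> = e" using K by simp
    finally show ?thesis using pairing[of N] by linarith
  qed
  have "(LINT t|circ. w (cis t) * (q t - 1 / (2 * pi))) \<le> sqrt (energy G / pi) * sqrt L"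
    using main by (rule field_le_epsilon)
  also have "(LINT t|circ. w (cis t) * (q t - 1 / (2 * pi)))
    = (LINT t|circ. q t * w (cis t) - w (cis t) / (2 * pi))"
    by (simp add: algebra_simps)
  also have "\<dots> = (LINT t|circ. q t * w (cis t)) - (LINT t|circ. w (cis t)) / (2 * pi)"
    using int_q[OF cw] integrable_circ[OF cw] by simp
  also have "(LINT t|circ. q t * w (cis t)) = (LINT t|circ. indicator E t * w (cis t)) / d"
    by (simp add: q_def)
  finally show ?thesis unfolding L_def d_def .
qed

section \<open>Two-slope test functions\<close>

lemma has_real_derivative_max_power2:
  "((\<lambda>x::real. (max 0 x)\<^sup>2 / 2) has_real_derivative max 0 x) (at x)"
proof (cases "x = 0")
  case True
  show ?thesis
    unfolding True CARAT_DERIV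
  proof (intro exI[of _ "\<lambda>z. max 0 z / 2"] conjI allI)
    show "isCont (\<lambda>z::real. max 0 z / 2) 0"
      by (intro continuous_intros) auto
  qed (auto simp: max_def power2_eq_square)
next
  case False
  then consider "x > 0" | "x < 0" by linarith
  then show ?thesis
  proof cases
    case 1
    have "((\<lambda>x::real. x\<^sup>2 / 2) has_real_derivative max 0 x) (at x)"
      using 1 by (auto intro!: derivative_eq_intros)
    then show ?thesis
      by (rule has_field_derivative_transform_within_open[of _ _ _ "{0<..}"]) (use 1 in auto)
  next
    case 2
    have "((\<lambda>x::real. 0) has_real_derivative max 0 x) (at x)"
      using 2 by simp
    then show ?thesis
      by (rule has_field_derivative_transform_within_open[of _ _ _ "{..<0}"]) (use 2 in auto)
  qed
qed

text \<open>A \<open>C\<^sup>1\<close> substitute for the convex kink: the positive part of \<open>s - t\<close>, with the slope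
  changing from \<open>0\<close> to \<open>1\<close> on \<open>[t, t + e]\<close>.\<close>

definition soft_pos :: "real \<Rightarrow> real \<Rightarrow> real \<Rightarrow> real" where
  "soft_pos e t s = e * ((max 0 ((s - t) / e))\<^sup>2 / 2 - (max 0 ((s - t) / e - 1))\<^sup>2 / 2)"

definition soft_step :: "real \<Rightarrow> real \<Rightarrow> real \<Rightarrow> real" where
  "soft_step e t s = max 0 ((s - t) / e) - max 0 ((s - t) / e - 1)"

lemma soft_pos_derivative:
  assumes "e > 0"
  shows "(soft_pos e t has_real_derivative soft_step e t s) (at s)"
proof -
  have f: "((\<lambda>s. (s - t) / e) has_real_derivative 1 / e) (at s)"
       "((\<lambda>s. (s - t) / e - 1) has_real_derivative 1 / e) (at s)"
    using assms by (auto intro!: derivative_eq_intros)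
  have "soft_pos e t = (\<lambda>s. e * ((max 0 ((s - t) / e))\<^sup>2 / 2 - (max 0 ((s - t) / e - 1))\<^sup>2 / 2))"
    by (simp add: soft_pos_def fun_eq_iff)
  then show ?thesis
    using DERIV_cmult[OF DERIV_diff[OF DERIV_chain2[OF has_real_derivative_max_power2 f(1)]
        DERIV_chain2[OF has_real_derivative_max_power2 f(2)]], of e] assms
    by (simp add: soft_step_def diff_divide_distrib[symmetric])
qed

lemma soft_step_continuous: "continuous_on UNIV (soft_step e t)"
  unfolding soft_step_def divide_inverse by (intro continuous_intros)

lemma soft_step_bounds:
  assumes "e > 0"
  shows "0 \<le> soft_step e t s" "soft_step e t s \<le> 1" "s \<le> t \<Longrightarrow> soft_step e t s = 0"
    "t + e \<le> s \<Longrightarrow> soft_step e t s = 1"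
  using assms by (auto simp: soft_step_def max_def field_simps)

lemma soft_pos_bounds:
  assumes "e > 0"
  shows "soft_pos e t s \<le> max 0 (s - t)" "max 0 (s - t) - e / 2 \<le> soft_pos e t s"
proof -
  define x where "x = (s - t) / e"
  define P where "P = (max 0 x)\<^sup>2 / 2 - (max 0 (x - 1))\<^sup>2 / 2"
  have "P \<le> max 0 x \<and> max 0 x - 1 / 2 \<le> P"
  proof -
    consider "x \<le> 0" | "0 \<le> x" "x \<le> 1" | "1 \<le> x" by linarith
    then show ?thesis
    proof cases
      case 2
      have "0 \<le> x * (1 - x)" "0 \<le> (1 - x)\<^sup>2" using 2 by auto
      moreover have "max 0 (x - 1) = 0" "max 0 x = x" using 2 by auto
      ultimately show ?thesis using 2
        unfolding P_def by (simp add: power2_eq_square algebra_simps)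
    next
      case 3
      then have "max 0 (x - 1) = x - 1" "max 0 x = x" by auto
      then have "P = x - 1 / 2"
        unfolding P_def by (simp add: power2_eq_square field_simps)
      then show ?thesis using 3 by simp
    qed (auto simp: P_def)
  qed
  then have "e * P \<le> e * max 0 x" "e * (max 0 x - 1 / 2) \<le> e * P"
    using assms by (auto intro!: mult_left_mono)
  moreover have "e * max 0 x = max 0 (s - t)"
    using assms by (auto simp: x_def max_def field_simps)
  ultimately show "soft_pos e t s \<le> max 0 (s - t)" "max 0 (s - t) - e / 2 \<le> soft_pos e t s"
    unfolding soft_pos_def P_def x_def by (auto simp: algebra_simps)
qed

lemma soft_pos_nonneg:
  assumes "e > 0"
  shows "0 \<le> soft_pos e t s"
proof -
  have "(max 0 ((s - t) / e - 1))\<^sup>2 \<le> (max 0 ((s - t) / e))\<^sup>2"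
    by (intro power_mono) auto
  then show ?thesis
    unfolding soft_pos_def using assms by (intro mult_nonneg_nonneg) auto
qed

lemma C1_gradient_comp:
  assumes u: "C1_gradient u G" and f: "\<And>s. (f has_real_derivative f' s) (at s)" and f': "continuous_on UNIV f'"
  shows "C1_gradient (\<lambda>z. f (u z)) (\<lambda>z. f' (u z) *\<^sub>R G z)"
  unfolding C1_gradient_def
proof (intro conjI allI)
  show "continuous_on UNIV (\<lambda>z. f' (u z) *\<^sub>R G z)"
    using u C1_gradient_continuous[OF u] unfolding C1_gradient_def
    by (intro continuous_intros continuous_on_compose2[OF f']) auto
  fix z
  have "(u has_derivative (\<lambda>h. G z \<bullet> h)) (at z)"
    using u by (simp add: C1_gradient_def)
  from has_derivative_compose[OF this f[unfolded has_field_derivative_def]]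
  show "((\<lambda>z. f (u z)) has_derivative (\<lambda>h. f' (u z) *\<^sub>R G z \<bullet> h)) (at z)"
    by simp
qed

section \<open>From the two-slope inequality to the gap between critical levels\<close>

lemma exp_3_le: "exp 3 \<le> (27::real)"
proof -
  have "exp (1::real) ^ 3 \<le> 3 ^ 3"
    using exp_le by (intro power_mono) auto
  then show ?thesis by (simp add: exp_of_nat_mult[symmetric])
qed

text \<open>With \<open>R = l / x1\<close> the tail energy is at most \<open>R\<close>; the slopes \<open>t1\<close> and
  \<open>(t2 - t1 - M) / R\<close> are optimal for this bound.\<close>

lemma level_gap_le:
  fixes t1 t2 x1 x2 l e1 e2 M :: real
  assumes t: "0 \<le> t1" "t1 \<le> t2" and l: "1 \<le> l" and x1: "8 * l \<le> x1"
    and gap: "x1 - t1\<^sup>2 \<le> l" "x2 - t2\<^sup>2 \<le> l"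
    and e: "0 \<le> e1" "0 \<le> e2" "e1 + e2 \<le> 1" and t1: "t1\<^sup>2 \<le> e1 * x1"
    and test: "\<And>\<alpha> \<beta>. 0 \<le> \<alpha> \<Longrightarrow> \<alpha> \<le> \<beta> \<Longrightarrow>
      \<alpha> * t2 + (\<beta> - \<alpha>) * (t2 - t1 - M) \<le> sqrt (\<alpha>\<^sup>2 * e1 + \<beta>\<^sup>2 * e2) * sqrt x2"
    and M: "0 \<le> M" "M \<le> exp (3 - x1) * sqrt x1" and x2: "0 \<le> x2"
  shows "t2\<^sup>2 - t1\<^sup>2 \<le> 473 * l"
proof -
  define R where "R = l / x1"
  define \<tau> where "\<tau> = t2 - t1"
  define \<tau>' where "\<tau>' = \<tau> - M"
  define X where "X = sqrt x1"
  have pos: "0 < x1" "0 < l" "0 < R" using l x1 by (auto simp: R_def)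
  have X: "0 < X" "X\<^sup>2 = x1" using pos by (auto simp: X_def)
  have "e1 * x1 \<le> 1 * x1"
    using e pos by (intro mult_right_mono) auto
  then have "t1\<^sup>2 \<le> X\<^sup>2" using t1 X by simp
  then have t1X: "t1 \<le> X" by (rule power2_le_imp_le) (use X in auto)
  \<comment> \<open>Scaling the energy split by \<open>x1\<close> turns
    \<open>t1\<^sup>2 \<le> e1 * x1\<close> into a bound for the tail energy: after the part below,
    at most the gap \<open>l\<close> is left of \<open>x1\<close>.\<close>
  have "x1 * e2 \<le> x1 - e1 * x1"
    using mult_left_mono[OF e(3), of x1] pos by (simp add: algebra_simps)
  also have "\<dots> \<le> l" using gap(1) t1 by argo
  finally have "x1 * e2 \<le> l" .
  then have e2R: "e2 \<le> R" using pos by (simp add: R_def field_simps)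
  have MX: "M * X \<le> 27 * l"
  proof -
    have "M * X \<le> exp (3 - x1) * sqrt x1 * X"
      using M X by (intro mult_right_mono) auto
    also have "\<dots> = exp 3 * (x1 * exp (- x1))"
      using pos by (simp add: X_def exp_diff exp_minus field_simps)
    also have "x1 * exp (- x1) \<le> 1"
    proof -
      have "x1 \<le> exp x1" using exp_ge_add_one_self[of x1] by linarith
      then show ?thesis by (simp add: exp_minus divide_simps)
    qed
    also have "exp 3 * 1 \<le> 27 * l"
      using exp_3_le l by linarith
    finally show ?thesis by simp
  qed
  \<comment> \<open>In the first case the optimal slopes would be in the wrong order, but then
    \<open>\<tau>'\<close> is small by itself and 28 l suffices. The constant 54 is twice the 27 of
    \<open>MX\<close>, for the case in which the excess exceeds half of \<open>\<tau>\<close>; the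
    remaining case gives 18.\<close>
  have tauX: "\<tau> * X \<le> 54 * l"
  proof (cases "\<tau>' \<le> R * t1")
    case True
    have "\<tau>' * X \<le> R * t1 * X"
      using True X by (intro mult_right_mono) auto
    also have "\<dots> \<le> R * X * X"
      using t1X pos X by (intro mult_right_mono mult_left_mono) auto
    also have "\<dots> = l"
      using X(2) pos by (simp add: R_def power2_eq_square mult.assoc)
    finally have "\<tau>' * X \<le> l" .
    then show ?thesis using MX l unfolding \<tau>'_def by (simp add: left_diff_distrib)
  next
    case False
    have "\<tau>' > 0"
      using False mult_nonneg_nonneg[of R t1] pos t by linarith
    \<comment> \<open>For the slopes \<open>t1\<close> and \<open>\<tau>' / R\<close> the left side
      of \<open>test\<close> is at least \<open>Z\<close> while the energy under the root is at most
      \<open>Z\<close>. One factor \<open>sqrt Z\<close> therefore cancels, leaving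
      \<open>Z \<le> x2\<close>.\<close>
    define Z where "Z = t1\<^sup>2 + \<tau>'\<^sup>2 / R"
    have Z: "0 < Z" unfolding Z_def using \<open>\<tau>' > 0\<close> pos by (intro add_nonneg_pos) auto
    have ab: "t1 \<le> \<tau>' / R" using False pos by (simp add: field_simps)
    have "Z = t1 * (t1 + \<tau>') + (\<tau>' / R - t1) * \<tau>'"
      unfolding Z_def by (simp add: power2_eq_square field_simps)
    also have "\<dots> \<le> t1 * t2 + (\<tau>' / R - t1) * \<tau>'"
      using t M unfolding \<tau>'_def \<tau>_def by (intro add_right_mono mult_left_mono) auto
    also have "\<dots> \<le> sqrt (t1\<^sup>2 * e1 + (\<tau>' / R)\<^sup>2 * e2) * sqrt x2"
      using test[OF t(1) ab] unfolding \<tau>'_def \<tau>_def by simp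
    also have "\<dots> \<le> sqrt Z * sqrt x2"
    proof (intro mult_right_mono real_sqrt_le_mono)
      have "t1\<^sup>2 * e1 + (\<tau>' / R)\<^sup>2 * e2 \<le> t1\<^sup>2 * 1 + (\<tau>' / R)\<^sup>2 * R"
        using e e2R by (intro add_mono mult_left_mono) auto
      also have "\<dots> = Z" unfolding Z_def using pos by (simp add: power2_eq_square)
      finally show "t1\<^sup>2 * e1 + (\<tau>' / R)\<^sup>2 * e2 \<le> Z" .
    qed (use x2 in auto)
    finally have "sqrt Z * sqrt Z \<le> sqrt Z * sqrt x2" using Z by simp
    then have "sqrt Z \<le> sqrt x2" by (rule mult_left_le_imp_le) (use Z in simp)
    then have "Z \<le> x2" by simp
    then have "\<tau>'\<^sup>2 / R \<le> t2\<^sup>2 - t1\<^sup>2 + l" using gap unfolding Z_def by linarith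
    also have "t2\<^sup>2 - t1\<^sup>2 = 2 * t1 * \<tau> + \<tau>\<^sup>2"
      unfolding \<tau>_def by (simp add: power2_eq_square algebra_simps)
    finally have *: "\<tau>'\<^sup>2 / R \<le> 2 * t1 * \<tau> + \<tau>\<^sup>2 + l" .
    \<comment> \<open>Either the excess \<open>M\<close> is at most half of \<open>\<tau>\<close>,
      so that \<open>\<tau>\<close> can be traded for \<open>\<tau>'\<close> at the cost of a factor
      2, or \<open>\<tau>\<close> is itself bounded by \<open>2 * M\<close>.\<close>
    show ?thesis
    proof (cases "\<tau> \<le> 2 * \<tau>'")
      case True
      define y where "y = X * \<tau>'"
      have y: "0 \<le> y" using X \<open>\<tau>' > 0\<close> by (simp add: y_def)
      have "0 \<le> \<tau>" using t by (simp add: \<tau>_def)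
      have y2: "y\<^sup>2 = x1 * \<tau>'\<^sup>2" using X by (simp add: y_def power_mult_distrib)
      have "2 * t1 * \<tau> \<le> 2 * X * (2 * \<tau>')"
        using t t1X True X \<open>0 \<le> \<tau>\<close> by (intro mult_mono) auto
      moreover have "\<tau>\<^sup>2 \<le> (2 * \<tau>')\<^sup>2"
        using True \<open>0 \<le> \<tau>\<close> by (intro power_mono) auto
      moreover have "\<tau>'\<^sup>2 / R = y\<^sup>2 / l" using pos by (simp add: y2 R_def)
      ultimately have "y\<^sup>2 / l \<le> 4 * y + 4 * \<tau>'\<^sup>2 + l"
      proof -
        assume "2 * t1 * \<tau> \<le> 2 * X * (2 * \<tau>')" "\<tau>\<^sup>2 \<le> (2 * \<tau>')\<^sup>2" "\<tau>'\<^sup>2 / R = y\<^sup>2 / l"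
        moreover have "2 * X * (2 * \<tau>') = 4 * y" "(2 * \<tau>')\<^sup>2 = 4 * \<tau>'\<^sup>2"
          by (simp_all add: y_def power_mult_distrib)
        ultimately show ?thesis using * by linarith
      qed
      then have "y\<^sup>2 \<le> l * (4 * y + 4 * \<tau>'\<^sup>2 + l)"
        using pos by (simp add: field_simps)
      \<comment> \<open>The threshold 8 in \<open>x1\<close> lets half of \<open>y\<^sup>2\<close>
        absorb the term \<open>4 * l * \<tau>'\<^sup>2\<close>; what is left is quadratic in y / l
        only.\<close>
      moreover have "8 * l * \<tau>'\<^sup>2 \<le> y\<^sup>2"
        unfolding y2 using x1 by (intro mult_right_mono) auto
      ultimately have yy: "y\<^sup>2 \<le> 8 * l * y + 2 * l\<^sup>2"
        by (simp add: algebra_simps power2_eq_square)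
      have "y \<le> 9 * l"
      proof (rule ccontr)
        assume "\<not> y \<le> 9 * l"
        then have y9: "9 * l < y" by simp
        then have "9 * l * y \<le> y * y" "l * (9 * l) \<le> l * y"
          using y pos by (intro mult_right_mono mult_left_mono; simp)+
        moreover have "0 < l * l" using pos by simp
        ultimately show False using yy by (simp add: power2_eq_square)
      qed
      moreover have "\<tau> * X \<le> 2 * \<tau>' * X" using True X by (intro mult_right_mono) auto
      ultimately show ?thesis using pos by (simp add: y_def mult_ac)
    next
      case False
      then have "\<tau> \<le> 2 * M" unfolding \<tau>'_def by simp
      then have "\<tau> * X \<le> 2 * M * X" using X by (intro mult_right_mono) auto
      then show ?thesis using MX by simp
    qed
  qed
  \<comment> \<open>The constant 473 is 108 + 365: twice 54 from the linear term 2 t1 tau, and 54^2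
    / 8 rounded up from tau^2.\<close>
  have "0 \<le> \<tau>" using t by (simp add: \<tau>_def)
  have "2 * t1 * \<tau> \<le> 2 * X * \<tau>"
    using t1X \<open>0 \<le> \<tau>\<close> by (intro mult_right_mono) auto
  moreover have "\<tau>\<^sup>2 * (8 * l) \<le> \<tau>\<^sup>2 * X\<^sup>2"
    using X x1 by (intro mult_left_mono) auto
  moreover have "\<tau>\<^sup>2 * X\<^sup>2 \<le> (54 * l)\<^sup>2"
    unfolding power_mult_distrib[symmetric] using tauX \<open>0 \<le> \<tau>\<close> X by (intro power_mono) auto
  ultimately have "\<tau>\<^sup>2 * (8 * l) \<le> 2916 * l * l"
    by (simp add: power2_eq_square)
  then have "\<tau>\<^sup>2 \<le> 365 * l"
    using pos by (simp add: field_simps)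
  moreover have "t2\<^sup>2 - t1\<^sup>2 = 2 * t1 * \<tau> + \<tau>\<^sup>2"
    unfolding \<tau>_def by (simp add: power2_eq_square algebra_simps)
  ultimately show ?thesis using tauX \<open>2 * t1 * \<tau> \<le> 2 * X * \<tau>\<close> by (simp add: mult_ac)
qed

section \<open>Level sets\<close>

locale unit_energy =
  fixes u :: "complex \<Rightarrow> real" and G :: "complex \<Rightarrow> complex"
  assumes u: "C1_gradient u G" and mean: "(LINT t|circ. u (cis t)) = 0" and energy: "energy G \<le> pi"
begin

definition above :: "real \<Rightarrow> real set" where
  "above s = {t \<in> {0..2*pi}. s \<le> u (cis t)}"

definition mass :: "real \<Rightarrow> real" where
  "mass s = measure circ (above s)"

text \<open>For a null level set the intended value is infinity, but division by zero yields a
  finite default. Statements about heights therefore assume positive mass, and null levels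
  contribute nothing to the layer-cake integral.\<close>

definition height :: "real \<Rightarrow> real" where
  "height s = ln (2 * pi / mass s) + 3"

text \<open>The level itself counts as below, in accordance with \<open>soft_step\<close>, which is
  still 0 at the kink. Division by pi makes the two parts sum to at most 1.\<close>

definition energy_below :: "real \<Rightarrow> real" where
  "energy_below s = (LINT x|polar. (if u (rcis (fst x) (snd x)) \<le> s then fst x * (norm (G (rcis (fst x) (snd x))))\<^sup>2 else 0)) / pi"

definition energy_above :: "real \<Rightarrow> real" where
  "energy_above s = (LINT x|polar. (if u (rcis (fst x) (snd x)) \<le> s then 0 else fst x * (norm (G (rcis (fst x) (snd x))))\<^sup>2)) / pi"

definition excess :: "real \<Rightarrow> real" where
  "excess s = (LINT t|circ. max 0 (u (cis t) - s)) / (2 * pi)"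

lemma cu: "continuous_on UNIV u"
  using u by (rule C1_gradient_continuous)

lemma cG: "continuous_on UNIV G"
  using u by (simp add: C1_gradient_def)

lemma cuc: "continuous_on UNIV (\<lambda>t. u (cis t))"
  by (intro continuous_on_compose2[OF cu] continuous_intros) auto

lemma above_borel: "above s \<in> sets borel" and above_subset: "above s \<subseteq> {0..2*pi}"
proof -
  have "closed ({0..2*pi} \<inter> {t. s \<le> u (cis t)})"
    by (intro closed_Int closed_Collect_le continuous_on_const cuc) auto
  also have "{0..2*pi} \<inter> {t. s \<le> u (cis t)} = above s"
    by (auto simp: above_def)
  finally show "above s \<in> sets borel" by simp
qed (auto simp: above_def)

lemma above_circ: "above s \<in> sets circ"
  using above_borel above_subset by (auto simp: circ_def sets_restrict_space)

lemma mass_nonneg: "0 \<le> mass s" and mass_le: "mass s \<le> 2 * pi"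
  using circ.bounded_measure[of "above s"] by (simp_all add: mass_def measure_circ)

lemma height_ge: "0 < mass s \<Longrightarrow> 3 \<le> height s"
  unfolding height_def using mass_le[of s] by (simp add: field_simps)

lemma mass_eq: "0 < mass s \<Longrightarrow> mass s = 2 * pi * exp (3 - height s)"
  unfolding height_def by (simp add: exp_minus)

lemma energy_split:
  "0 \<le> energy_below s" "0 \<le> energy_above s" "energy_below s + energy_above s \<le> 1"
  "0 \<le> a \<Longrightarrow> 0 \<le> b \<Longrightarrow> continuous_on UNIV f \<Longrightarrow> (\<And>r. 0 \<le> f r)
    \<Longrightarrow> (\<And>r. r \<le> s \<Longrightarrow> f r \<le> a) \<Longrightarrow> (\<And>r. s < r \<Longrightarrow> f r \<le> b)
    \<Longrightarrow> energy (\<lambda>z. f (u z) *\<^sub>R G z) / pi \<le> a\<^sup>2 * energy_below s + b\<^sup>2 * energy_above s"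
proof -
  define D where "D = (\<lambda>x. fst x * (norm (G (rcis (fst x) (snd x))))\<^sup>2)"
  define U where "U = (\<lambda>x. u (rcis (fst x) (snd x)))"
  have cU: "continuous_on UNIV U" and cD: "continuous_on UNIV D"
    unfolding U_def D_def by (intro continuous_intros continuous_on_compose2[OF cu] continuous_on_compose2[OF cG]; simp)+
  have [measurable]: "U \<in> borel_measurable polar" "D \<in> borel_measurable polar"
    using cU cD by (auto intro!: measurable_polar borel_measurable_continuous_onI)
  have D0: "0 \<le> D x" if "x \<in> space polar" for x
    using that by (auto simp: D_def space_pair_measure)
  have iD: "integrable polar D" by (rule integrable_polar[OF cD])
  have i1: "integrable polar (\<lambda>x. if U x \<le> s then D x else 0)"
    by (rule Bochner_Integration.integrable_bound[OF iD]) auto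
  have i2: "integrable polar (\<lambda>x. if U x \<le> s then 0 else D x)"
    by (rule Bochner_Integration.integrable_bound[OF iD]) auto
  have b: "energy_below s = (LINT x|polar. (if U x \<le> s then D x else 0)) / pi"
    unfolding energy_below_def U_def D_def ..
  have a: "energy_above s = (LINT x|polar. (if U x \<le> s then 0 else D x)) / pi"
    unfolding energy_above_def U_def D_def ..
  show "0 \<le> energy_below s" "0 \<le> energy_above s"
    unfolding a b by (auto intro!: divide_nonneg_pos integral_nonneg_AE AE_I2 D0)
  have "(LINT x|polar. (if U x \<le> s then D x else 0)) + (LINT x|polar. (if U x \<le> s then 0 else D x)) = (LINT x|polar. D x)"
    unfolding Bochner_Integration.integral_add[OF i1 i2, symmetric]
    by (intro Bochner_Integration.integral_cong) auto
  also have "\<dots> \<le> pi" using energy unfolding energy_def D_def .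
  finally show "energy_below s + energy_above s \<le> 1"
    unfolding a b by (simp add: add_divide_distrib[symmetric])
  assume ab: "0 \<le> a" "0 \<le> b" and f: "continuous_on UNIV f" "\<And>r. 0 \<le> f r"
    and fa: "\<And>r. r \<le> s \<Longrightarrow> f r \<le> a" and fb: "\<And>r. s < r \<Longrightarrow> f r \<le> b"
  have "energy (\<lambda>z. f (u z) *\<^sub>R G z) = (LINT x|polar. (f (U x))\<^sup>2 * D x)"
    unfolding energy_def D_def U_def by (simp add: power_mult_distrib mult_ac)
  also have "\<dots> \<le> (LINT x|polar. a\<^sup>2 * (if U x \<le> s then D x else 0) + b\<^sup>2 * (if U x \<le> s then 0 else D x))"
  proof (rule integral_mono)
    show "integrable polar (\<lambda>x. (f (U x))\<^sup>2 * D x)"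
      by (intro integrable_polar continuous_intros cD continuous_on_compose2[OF f(1) cU]) auto
    show "integrable polar (\<lambda>x. a\<^sup>2 * (if U x \<le> s then D x else 0) + b\<^sup>2 * (if U x \<le> s then 0 else D x))"
      using i1 i2 by (intro Bochner_Integration.integrable_add integrable_mult_right)
    fix x assume x: "x \<in> space polar"
    have "(f (U x))\<^sup>2 \<le> a\<^sup>2" if "U x \<le> s" using fa[OF that] f(2) by (intro power_mono) auto
    moreover have "(f (U x))\<^sup>2 \<le> b\<^sup>2" if "\<not> U x \<le> s" using fb[of "U x"] that f(2) by (intro power_mono) auto
    ultimately show "(f (U x))\<^sup>2 * D x \<le> a\<^sup>2 * (if U x \<le> s then D x else 0) + b\<^sup>2 * (if U x \<le> s then 0 else D x)"
      using D0[OF x] by (auto intro!: mult_right_mono)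
  qed
  also have "\<dots> = a\<^sup>2 * (LINT x|polar. (if U x \<le> s then D x else 0)) + b\<^sup>2 * (LINT x|polar. (if U x \<le> s then 0 else D x))"
    using i1 i2 by (subst Bochner_Integration.integral_add) (auto intro!: integrable_mult_right)
  finally show "energy (\<lambda>z. f (u z) *\<^sub>R G z) / pi \<le> a\<^sup>2 * energy_below s + b\<^sup>2 * energy_above s"
    unfolding a b by (simp add: field_simps)
qed

section \<open>Test functions of u averaged over level sets\<close>

lemma average_ge:
  assumes "0 < mass s" and f: "continuous_on UNIV f" and le: "\<And>t. t \<in> above s \<Longrightarrow> c \<le> f t"
  shows "c \<le> (LINT t|circ. indicator (above s) t * f t) / mass s"
proof -
  have "c * mass s = (LINT t|circ. indicator (above s) t * c)"
    using above_circ above_subset by (simp add: mass_def Int_absorb2)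
  also have "\<dots> \<le> (LINT t|circ. indicator (above s) t * f t)"
    using integrable_mult_indicator[OF above_circ integrable_circ[OF f]]
      integrable_mult_indicator[OF above_circ integrable_circ, of "\<lambda>_. c"]
    by (intro integral_mono) (auto simp: indicator_def le)
  finally show ?thesis using assms(1) by (simp add: field_simps)
qed

text \<open>As \<open>f\<close> is nondecreasing, f(u) is at least \<open>f s\<close> on
  \<open>above s\<close>, so \<open>f s\<close> is at most the average there. The average estimate
  for f(u) then applies, and the slope bounds on either side of \<open>t\<close> weight the two
  parts of the energy.\<close>

lemma level_test:
  assumes f: "\<And>s. (f has_real_derivative f' s) (at s)" "continuous_on UNIV f'" "\<And>r. 0 \<le> f' r"
    and ab: "0 \<le> a" "0 \<le> b" "\<And>r. r \<le> t \<Longrightarrow> f' r \<le> a" "\<And>r. t < r \<Longrightarrow> f' r \<le> b"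
    and s: "0 < mass s"
  shows "f s - (LINT \<theta>|circ. f (u (cis \<theta>))) / (2 * pi)
    \<le> sqrt (a\<^sup>2 * energy_below t + b\<^sup>2 * energy_above t) * sqrt (height s)"
proof -
  have cf: "continuous_on UNIV f"
    by (meson f(1) DERIV_isCont continuous_at_imp_continuous_on)
  have mono: "f x \<le> f y" if "x \<le> y" for x y
    using that f(1,3) by (meson DERIV_nonneg_imp_nondecreasing)
  have "f s \<le> (LINT \<theta>|circ. indicator (above s) \<theta> * f (u (cis \<theta>))) / mass s"
    by (intro average_ge s continuous_on_compose2[OF cf cuc]) (auto simp: above_def intro: mono)
  then have "f s - (LINT \<theta>|circ. f (u (cis \<theta>))) / (2 * pi)
    \<le> sqrt (energy (\<lambda>z. f' (u z) *\<^sub>R G z) / pi) * sqrt (height s)"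
    using average_minus_mean_le[OF C1_gradient_comp[OF u f(1,2)] above_borel above_subset s[unfolded mass_def]]
    unfolding height_def mass_def by linarith
  also have "\<dots> \<le> sqrt (a\<^sup>2 * energy_below t + b\<^sup>2 * energy_above t) * sqrt (height s)"
    using height_ge[OF s] energy_split(4)[OF ab(1,2) f(2,3) ab(3,4)]
    by (intro mult_right_mono real_sqrt_le_mono) auto
  finally show ?thesis .
qed

text \<open>The test function is u truncated at the level \<open>s\<close>: it costs no energy above
  \<open>s\<close>, and truncation makes the mean nonpositive, which only strengthens the
  bound.\<close>

lemma level_sq_le:
  assumes s: "0 < mass s" "0 \<le> s"
  shows "s\<^sup>2 \<le> energy_below s * height s"
proof -
  have "s \<le> sqrt (energy_below s) * sqrt (height s) + e" if e: "e > 0" for e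
  proof -
    \<comment> \<open>The smoothing starts at \<open>s - e\<close>, so the slope has dropped to 0
      when \<open>s\<close> is reached and the coefficient of \<open>energy_above s\<close> is
      exactly 0. The price is at most \<open>e\<close> in the value at \<open>s\<close>.\<close>
    have 1: "s - e \<le> s - soft_pos e (s - e) s"
      using soft_pos_bounds(1)[OF e, of "s - e" s] e by simp
    have "(s - soft_pos e (s - e) s) - (LINT \<theta>|circ. u (cis \<theta>) - soft_pos e (s - e) (u (cis \<theta>))) / (2 * pi)
      \<le> sqrt (1\<^sup>2 * energy_below s + 0\<^sup>2 * energy_above s) * sqrt (height s)"
      using soft_step_bounds[OF e, of "s - e"]
      by (intro level_test[where f' = "\<lambda>r. 1 - soft_step e (s - e) r"])
         (auto intro!: derivative_eq_intros soft_pos_derivative e continuous_intros soft_step_continuous s)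
    moreover have "(LINT \<theta>|circ. u (cis \<theta>) - soft_pos e (s - e) (u (cis \<theta>))) \<le> (LINT \<theta>|circ. u (cis \<theta>))"
    proof (rule integral_mono)
      have "continuous_on UNIV (soft_pos e (s - e))"
        by (meson e soft_pos_derivative DERIV_isCont continuous_at_imp_continuous_on)
      then show "integrable circ (\<lambda>\<theta>. u (cis \<theta>) - soft_pos e (s - e) (u (cis \<theta>)))"
        by (intro integrable_circ continuous_intros cuc) (auto intro: continuous_on_compose2 cuc)
      show "u (cis \<theta>) - soft_pos e (s - e) (u (cis \<theta>)) \<le> u (cis \<theta>)" for \<theta>
        using soft_pos_bounds(2)[OF e, of "u (cis \<theta>)" "s - e"]
          soft_pos_nonneg[OF e] by simp
    qed (intro integrable_circ cuc)
    ultimately show ?thesis using 1 mean by (simp add: divide_nonpos_pos) (smt (verit) divide_nonpos_pos pi_gt_zero)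
  qed
  then have "s \<le> sqrt (energy_below s) * sqrt (height s)"
    by (rule field_le_epsilon)
  then have "s\<^sup>2 \<le> (sqrt (energy_below s) * sqrt (height s))\<^sup>2"
    using s by (intro power_mono)
  then show ?thesis
    using energy_split(1)[of s] height_ge[OF s(1)] by (simp add: power_mult_distrib)
qed

text \<open>The linear part \<open>a * u\<close> has mean 0, so the mean of the test function is at
  most \<open>(b - a) * excess t\<close>. This supplies the hypothesis \<open>test\<close> of
  \<open>level_gap_le\<close>, with \<open>M\<close> the excess.\<close>

lemma two_slopes_le:
  assumes s: "0 < mass s" "t \<le> s" and ab: "0 \<le> a" "a \<le> b"
  shows "a * s + (b - a) * (s - t - excess t) \<le> sqrt (a\<^sup>2 * energy_below t + b\<^sup>2 * energy_above t) * sqrt (height s)"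
proof (rule field_le_epsilon)
  fix \<epsilon> :: real assume "\<epsilon> > 0"
  \<comment> \<open>The added 1 covers the case of equal slopes.\<close>
  define e where "e = \<epsilon> / (b - a + 1)"
  have e: "0 < e" "(b - a) * e \<le> \<epsilon>"
    using ab \<open>\<epsilon> > 0\<close> by (auto simp: e_def field_simps)
  have "(a * s + (b - a) * soft_pos e t s) - (LINT \<theta>|circ. a * u (cis \<theta>) + (b - a) * soft_pos e t (u (cis \<theta>))) / (2 * pi)
      \<le> sqrt (a\<^sup>2 * energy_below t + b\<^sup>2 * energy_above t) * sqrt (height s)"
  proof (rule level_test[where f' = "\<lambda>r. a + (b - a) * soft_step e t r"])
    show "0 \<le> a + (b - a) * soft_step e t r" for r
      using ab soft_step_bounds(1)[OF e(1), of t r] by simp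
    show "a + (b - a) * soft_step e t r \<le> b" for r
      using mult_left_mono[OF soft_step_bounds(2)[OF e(1), of t r], of "b - a"] ab by simp
    show "a + (b - a) * soft_step e t r \<le> a" if "r \<le> t" for r
      using soft_step_bounds(3)[OF e(1) that] by simp
    show "((\<lambda>s. a * s + (b - a) * soft_pos e t s) has_real_derivative a + (b - a) * soft_step e t r) (at r)" for r
      by (auto intro!: derivative_eq_intros soft_pos_derivative e)
    show "continuous_on UNIV (\<lambda>r. a + (b - a) * soft_step e t r)"
      by (intro continuous_intros soft_step_continuous)
  qed (use ab s in auto)
  moreover have "(LINT \<theta>|circ. a * u (cis \<theta>) + (b - a) * soft_pos e t (u (cis \<theta>)))
     \<le> (LINT \<theta>|circ. a * u (cis \<theta>) + (b - a) * max 0 (u (cis \<theta>) - t))"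
  proof (rule integral_mono)
    have "continuous_on UNIV (soft_pos e t)"
      by (meson e soft_pos_derivative DERIV_isCont continuous_at_imp_continuous_on)
    then show "integrable circ (\<lambda>\<theta>. a * u (cis \<theta>) + (b - a) * soft_pos e t (u (cis \<theta>)))"
      by (intro integrable_circ continuous_intros cuc) (auto intro: continuous_on_compose2 cuc)
    show "a * u (cis \<theta>) + (b - a) * soft_pos e t (u (cis \<theta>)) \<le> a * u (cis \<theta>) + (b - a) * max 0 (u (cis \<theta>) - t)" for \<theta>
      using ab soft_pos_bounds(1)[OF e(1)] by (intro add_left_mono mult_left_mono) auto
  qed (intro integrable_circ continuous_intros cuc)
  moreover have "(LINT \<theta>|circ. a * u (cis \<theta>) + (b - a) * max 0 (u (cis \<theta>) - t)) = (b - a) * (2 * pi * excess t)"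
    unfolding excess_def
    by (subst Bochner_Integration.integral_add) (auto simp: mean intro!: integrable_circ continuous_intros cuc)
  ultimately have "(LINT \<theta>|circ. a * u (cis \<theta>) + (b - a) * soft_pos e t (u (cis \<theta>))) / (2 * pi) \<le> (b - a) * excess t"
    and "(a * s + (b - a) * soft_pos e t s) - (LINT \<theta>|circ. a * u (cis \<theta>) + (b - a) * soft_pos e t (u (cis \<theta>))) / (2 * pi)
      \<le> sqrt (a\<^sup>2 * energy_below t + b\<^sup>2 * energy_above t) * sqrt (height s)"
    by (simp_all add: pos_divide_le_eq mult_ac)
  then have "(a * s + (b - a) * soft_pos e t s) - (b - a) * excess t
    \<le> sqrt (a\<^sup>2 * energy_below t + b\<^sup>2 * energy_above t) * sqrt (height s)"
    by linarith
  moreover have "(b - a) * (s - t - e) \<le> (b - a) * soft_pos e t s"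
    using soft_pos_bounds(2)[OF e(1), where s = s and t = t] e(1) ab s by (intro mult_left_mono) auto
  ultimately show "a * s + (b - a) * (s - t - excess t)
    \<le> sqrt (a\<^sup>2 * energy_below t + b\<^sup>2 * energy_above t) * sqrt (height s) + \<epsilon>"
    using e(2) by (simp add: algebra_simps)
qed

text \<open>On \<open>above s\<close> the positive part of u - s is at most u because
  \<open>s\<close> is nonnegative, and the average of u there is at most
  \<open>sqrt (height s)\<close>. Multiplying by the mass, which is exponentially small in the
  height, gives the bound.\<close>

lemma excess_le:
  assumes s: "0 < mass s" "0 \<le> s"
  shows "0 \<le> excess s" "excess s \<le> exp (3 - height s) * sqrt (height s)"
proof -
  show "0 \<le> excess s" unfolding excess_def by simp
  have i: "integrable circ (\<lambda>t. indicator (above s) t * u (cis t))"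
    using integrable_mult_indicator[OF above_circ integrable_circ[OF cuc]] by simp
  have "(LINT t|circ. indicator (above s) t * u (cis t)) / mass s \<le> sqrt (energy G / pi) * sqrt (height s)"
    using average_minus_mean_le[OF u above_borel above_subset s(1)[unfolded mass_def]] mean
    unfolding height_def mass_def by simp
  also have "\<dots> \<le> 1 * sqrt (height s)"
    using energy height_ge[OF s(1)] by (intro mult_right_mono) auto
  finally have le: "(LINT t|circ. indicator (above s) t * u (cis t)) \<le> mass s * sqrt (height s)"
    using s by (simp add: field_simps)
  have "(LINT t|circ. max 0 (u (cis t) - s)) \<le> (LINT t|circ. indicator (above s) t * u (cis t))"
    by (rule integral_mono[OF _ i])
       (use s in \<open>auto simp: above_def indicator_def intro!: integrable_circ continuous_intros cuc\<close>)
  then have "excess s \<le> mass s * sqrt (height s) / (2 * pi)"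
    unfolding excess_def using le by (intro divide_right_mono) auto
  then show "excess s \<le> exp (3 - height s) * sqrt (height s)"
    unfolding mass_eq[OF s(1)] by simp
qed

text \<open>Levels are parametrised by their square y. Since the height is at least y, every y
  beyond 8 l meets the threshold of \<open>level_gap_le\<close>, and any two such values differ by
  at most 473 l.\<close>

lemma critical_levels:
  assumes l: "1 \<le> l"
  shows "\<exists>c. \<forall>y\<ge>0. 0 < mass (sqrt y) \<longrightarrow> height (sqrt y) - y \<le> l \<longrightarrow> y \<in> {0..8 * l} \<union> {c..c + 473 * l}"
proof -
  define Y where "Y = {y. 0 \<le> y \<and> 0 < mass (sqrt y) \<and> height (sqrt y) - y \<le> l \<and> 8 * l < y}"
  have gap: "y2 - y1 \<le> 473 * l" if y: "y1 \<in> Y" "y2 \<in> Y" "y1 \<le> y2" for y1 y2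
  proof -
    note y1 = y(1)[unfolded Y_def, simplified] and y2 = y(2)[unfolded Y_def, simplified]
    have sq: "(sqrt y1)\<^sup>2 = y1" "(sqrt y2)\<^sup>2 = y2" using y1 y2 by simp_all
    have le1: "y1 \<le> energy_below (sqrt y1) * height (sqrt y1)"
      using level_sq_le[of "sqrt y1"] y1 by simp
    also have "\<dots> \<le> 1 * height (sqrt y1)"
      using energy_split(1-3)[of "sqrt y1"] height_ge[of "sqrt y1"] y1 by (intro mult_right_mono) auto
    finally have h1: "8 * l \<le> height (sqrt y1)" using y1 by simp
    have "(sqrt y2)\<^sup>2 - (sqrt y1)\<^sup>2 \<le> 473 * l"
    proof (rule level_gap_le)
      show "\<alpha> * sqrt y2 + (\<beta> - \<alpha>) * (sqrt y2 - sqrt y1 - excess (sqrt y1))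
        \<le> sqrt (\<alpha>\<^sup>2 * energy_below (sqrt y1) + \<beta>\<^sup>2 * energy_above (sqrt y1)) * sqrt (height (sqrt y2))"
        if "0 \<le> \<alpha>" "\<alpha> \<le> \<beta>" for \<alpha> \<beta>
        using two_slopes_le that y2 y by auto
    qed (use sq y1 y2 y l h1 le1 energy_split excess_le[of "sqrt y1"] height_ge[of "sqrt y2"] in auto)
    then show ?thesis unfolding sq .
  qed
  \<comment> \<open>If \<open>Y\<close> is empty the infimum is arbitrary, which is harmless: the
    claim concerns members of \<open>Y\<close> only.\<close>
  define c where "c = Inf Y"
  have bdd: "bdd_below Y" by (rule bdd_belowI[of _ 0]) (auto simp: Y_def)
  have "y \<in> {c..c + 473 * l}" if "y \<in> Y" for y
  proof -
    have "c \<le> y" unfolding c_def using bdd that by (rule cInf_lower[rotated])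
    moreover have "y - 473 * l \<le> c"
      unfolding c_def
    proof (rule cInf_greatest)
      show "y - 473 * l \<le> x" if "x \<in> Y" for x
        using gap[OF that \<open>y \<in> Y\<close>] l by (cases "x \<le> y") auto
    qed (use that in auto)
    ultimately show ?thesis by simp
  qed
  then show ?thesis by (intro exI[of _ c]) (force simp: Y_def)
qed

end

section \<open>The layer-cake estimate\<close>

text \<open>The k-th term bounds the part of the layer-cake integral where height minus y lies
  between k and k + 1. The factor 481 is 8 + 473, from the two intervals of
  \<open>critical_levels\<close> with l = k + 1.\<close>

definition layer_const :: real where
  "layer_const = (\<Sum>k. 2 * pi * exp 3 * exp (- real k) * (481 * (real k + 1)))"

lemma layer_const_summable: "summable (\<lambda>k. 2 * pi * exp 3 * exp (- real k) * (481 * (real k + 1)))"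
proof -
  have "(\<lambda>n. of_nat (Suc n) * exp (- 1 :: real) ^ n) sums (1 / (1 - exp (- 1))\<^sup>2)"
    by (rule geometric_deriv_sums) simp
  then have "summable (\<lambda>k. (real k + 1) * exp (- 1) ^ k)"
    by (auto simp: sums_iff add.commute)
  then have "summable (\<lambda>k. 2 * pi * exp 3 * 481 * ((real k + 1) * exp (- 1) ^ k))"
    by (rule summable_mult)
  moreover have "exp (- 1) ^ k = exp (- real k)" for k
    by (simp add: exp_of_nat_mult[symmetric])
  ultimately show ?thesis by (simp only: mult_ac)
qed

lemma layer_const_nonneg: "0 \<le> layer_const"
  unfolding layer_const_def by (intro suminf_nonneg layer_const_summable) auto

context unit_energy
begin

text \<open>The integrand is \<open>2 * pi * exp 3 * exp (- h)\<close> with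
  \<open>h = height (sqrt y) - y\<close>, and \<open>h\<close> is nonnegative by
  \<open>level_sq_le\<close>. Slicing by the integer part k of \<open>h\<close> confines each slice
  to \<open>J k\<close>, whose measure grows only linearly in k.\<close>

lemma layer_integral_le:
  "(\<integral>\<^sup>+y. ennreal (exp y * mass (sqrt y)) * indicator {0..} y \<partial>lborel) \<le> ennreal layer_const"
proof -
  have "\<exists>c. \<forall>k::nat. \<forall>y\<ge>0. 0 < mass (sqrt y) \<longrightarrow> height (sqrt y) - y \<le> real k + 1 \<longrightarrow>
      y \<in> {0..8 * (real k + 1)} \<union> {c k..c k + 473 * (real k + 1)}"
    using critical_levels[of "real _ + 1"] by (intro choice allI) simp
  then obtain c where c: "\<And>k y. 0 \<le> y \<Longrightarrow> 0 < mass (sqrt y) \<Longrightarrow> height (sqrt y) - y \<le> real k + 1 \<Longrightarrow>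
      y \<in> {0..8 * (real k + 1)} \<union> {c k..c k + 473 * (real k + 1)}"
    by blast
  define J where "J = (\<lambda>k. {0..8 * (real k + 1)} \<union> {c k..c k + 473 * (real k + 1)})"
  define F where "F = (\<lambda>k y. ennreal (2 * pi * exp 3 * exp (- real k)) * indicator (J k) y)"
  have J: "emeasure lborel (J k) \<le> ennreal (481 * (real k + 1))" for k
  proof -
    have "emeasure lborel (J k) \<le> emeasure lborel {0..8 * (real k + 1)} + emeasure lborel {c k..c k + 473 * (real k + 1)}"
      unfolding J_def by (intro emeasure_subadditive) auto
    also have "\<dots> = ennreal (481 * (real k + 1))"
      by (simp add: ennreal_plus[symmetric] del: ennreal_plus)
    finally show ?thesis .
  qed
  have [measurable]: "J k \<in> sets borel" for k unfolding J_def by auto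
  have "ennreal (exp y * mass (sqrt y)) * indicator {0..} y \<le> (\<Sum>k. F k y)" for y
  proof (cases "0 \<le> y \<and> 0 < mass (sqrt y)")
    case True
    then have y: "0 \<le> y" and s: "0 < mass (sqrt y)" by auto
    define h where "h = height (sqrt y) - y"
    have "(sqrt y)\<^sup>2 \<le> energy_below (sqrt y) * height (sqrt y)"
      using level_sq_le[OF s] y by simp
    also have "\<dots> \<le> 1 * height (sqrt y)"
      using energy_split(1-3)[of "sqrt y"] height_ge[OF s] by (intro mult_right_mono) auto
    finally have h: "0 \<le> h" using y by (simp add: h_def)
    define k where "k = nat \<lfloor>h\<rfloor>"
    have k: "real k \<le> h" "h \<le> real k + 1" using h unfolding k_def by linarith+
    have "exp y * mass (sqrt y) = 2 * pi * exp 3 * exp (- h)"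
      unfolding mass_eq[OF s] h_def by (simp add: exp_diff exp_minus field_simps)
    also have "\<dots> \<le> 2 * pi * exp 3 * exp (- real k)"
      using k by (intro mult_left_mono) auto
    finally have "ennreal (exp y * mass (sqrt y)) * indicator {0..} y \<le> F k y"
      using c[OF y s, of k] k y unfolding F_def J_def h_def by (auto simp: indicator_def intro!: ennreal_leI)
    also have "\<dots> \<le> (\<Sum>k. F k y)"
      using sum_le_suminf[of "\<lambda>k. F k y" "{k}"] by simp
    finally show ?thesis .
  next
    case False
    then have *: "ennreal (exp y * mass (sqrt y)) * indicator {0..} y = 0"
      using mass_nonneg[of "sqrt y"] by (auto simp: indicator_def)
    show ?thesis unfolding * by simp
  qed
  then have "(\<integral>\<^sup>+y. ennreal (exp y * mass (sqrt y)) * indicator {0..} y \<partial>lborel) \<le> (\<integral>\<^sup>+y. (\<Sum>k. F k y) \<partial>lborel)"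
    by (intro nn_integral_mono)
  also have "\<dots> = (\<Sum>k. (\<integral>\<^sup>+y. F k y \<partial>lborel))"
    unfolding F_def by (intro nn_integral_suminf) measurable
  also have "\<dots> = (\<Sum>k. ennreal (2 * pi * exp 3 * exp (- real k)) * emeasure lborel (J k))"
    unfolding F_def by (subst nn_integral_cmult_indicator) auto
  also have "\<dots> \<le> (\<Sum>k. ennreal (2 * pi * exp 3 * exp (- real k)) * ennreal (481 * (real k + 1)))"
    by (intro suminf_le mult_left_mono J summableI) auto
  also have "\<dots> = (\<Sum>k. ennreal (2 * pi * exp 3 * exp (- real k) * (481 * (real k + 1))))"
    by (intro suminf_cong ennreal_mult''[symmetric]) simp
  also have "\<dots> = ennreal layer_const"
    unfolding layer_const_def by (intro suminf_ennreal2 layer_const_summable) auto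
  finally show ?thesis .
qed

lemma nn_integral_layers_le:
  "(\<integral>\<^sup>+t. \<integral>\<^sup>+y. ennreal (exp y) * (indicator {0..} y * of_bool (sqrt y \<le> u (cis t))) \<partial>lborel \<partial>circ) \<le> ennreal layer_const"
proof -
  interpret L: pair_sigma_finite lborel circ ..
  have [measurable]: "(\<lambda>t. u (cis t)) \<in> borel_measurable circ"
    using cuc by (intro measurable_circ borel_measurable_continuous_onI)
  have "(\<integral>\<^sup>+t. \<integral>\<^sup>+y. ennreal (exp y) * (indicator {0..} y * of_bool (sqrt y \<le> u (cis t))) \<partial>lborel \<partial>circ)
    = (\<integral>\<^sup>+y. \<integral>\<^sup>+t. ennreal (exp y) * (indicator {0..} y * of_bool (sqrt y \<le> u (cis t))) \<partial>circ \<partial>lborel)"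
    by (rule L.Fubini') measurable
  also have "\<dots> = (\<integral>\<^sup>+y. ennreal (exp y * mass (sqrt y)) * indicator {0..} y \<partial>lborel)"
  proof (intro nn_integral_cong)
    fix y :: real
    have "(\<integral>\<^sup>+t. ennreal (exp y) * (indicator {0..} y * of_bool (sqrt y \<le> u (cis t))) \<partial>circ)
      = (\<integral>\<^sup>+t. (ennreal (exp y) * indicator {0..} y) * indicator (above (sqrt y)) t \<partial>circ)"
      by (intro nn_integral_cong) (auto simp: above_def indicator_def)
    also have "\<dots> = ennreal (exp y) * indicator {0..} y * emeasure circ (above (sqrt y))"
      by (intro nn_integral_cmult_indicator above_circ)
    also have "\<dots> = ennreal (exp y * mass (sqrt y)) * indicator {0..} y"
      unfolding mass_def circ.emeasure_eq_measure by (simp add: ennreal_mult'' mult_ac)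
    finally show "(\<integral>\<^sup>+t. ennreal (exp y) * (indicator {0..} y * of_bool (sqrt y \<le> u (cis t))) \<partial>circ)
      = ennreal (exp y * mass (sqrt y)) * indicator {0..} y" .
  qed
  finally show ?thesis using layer_integral_le by simp
qed

lemma unit_energy_uminus: "unit_energy (\<lambda>z. - u z) (\<lambda>z. - G z)"
proof
  show "C1_gradient (\<lambda>z. - u z) (\<lambda>z. - G z)"
    using u unfolding C1_gradient_def by (auto intro!: continuous_intros derivative_eq_intros)
qed (use mean energy in \<open>simp_all add: energy_def\<close>)

text \<open>Write exp (v^2) as 1 plus the integral of exp y over y from 0 to v^2. The condition sqrt
  y <= |v| splits by the sign of v, so the layer bound is used for u and for -u.\<close>

theorem nn_integral_exp_square_le:
  "(\<integral>\<^sup>+t. ennreal (exp ((u (cis t))\<^sup>2)) \<partial>circ) \<le> ennreal (2 * pi + 2 * layer_const)"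
proof -
  interpret neg: unit_energy "\<lambda>z. - u z" "\<lambda>z. - G z"
    by (rule unit_energy_uminus)
  have [measurable]: "(\<lambda>t. u (cis t)) \<in> borel_measurable circ"
    using cuc by (intro measurable_circ borel_measurable_continuous_onI)
  define A where "A = (\<lambda>t. \<integral>\<^sup>+y. ennreal (exp y) * (indicator {0..} y * of_bool (sqrt y \<le> u (cis t))) \<partial>lborel)"
  define B where "B = (\<lambda>t. \<integral>\<^sup>+y. ennreal (exp y) * (indicator {0..} y * of_bool (sqrt y \<le> - u (cis t))) \<partial>lborel)"
  have mA: "A \<in> borel_measurable circ" "B \<in> borel_measurable circ"
    unfolding A_def B_def by measurable
  have "ennreal (exp ((u (cis t))\<^sup>2)) \<le> 1 + (A t + B t)" for t
  proof -
    define v where "v = u (cis t)"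
    have "(\<integral>\<^sup>+y. ennreal (exp y) * indicator {0..v\<^sup>2} y \<partial>lborel) = ennreal (exp (v\<^sup>2) - exp 0)"
      by (rule nn_integral_FTC_Icc) (auto intro!: derivative_eq_intros)
    then have "ennreal (exp (v\<^sup>2)) = 1 + (\<integral>\<^sup>+y. ennreal (exp y) * indicator {0..v\<^sup>2} y \<partial>lborel)"
      by (simp add: ennreal_1[symmetric] ennreal_plus[symmetric] del: ennreal_1 ennreal_plus)
    also have "(\<integral>\<^sup>+y. ennreal (exp y) * indicator {0..v\<^sup>2} y \<partial>lborel)
      \<le> (\<integral>\<^sup>+y. ennreal (exp y) * (indicator {0..} y * of_bool (sqrt y \<le> v))
          + ennreal (exp y) * (indicator {0..} y * of_bool (sqrt y \<le> - v)) \<partial>lborel)"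
    proof (intro nn_integral_mono)
      fix y :: real
      have "sqrt y \<le> v \<or> sqrt y \<le> - v" if "0 \<le> y" "y \<le> v\<^sup>2"
        using real_sqrt_le_mono[OF that(2)] by (auto simp: abs_le_iff abs_if split: if_splits)
      then show "ennreal (exp y) * indicator {0..v\<^sup>2} y \<le> ennreal (exp y) * (indicator {0..} y * of_bool (sqrt y \<le> v))
          + ennreal (exp y) * (indicator {0..} y * of_bool (sqrt y \<le> - v))"
        by (auto simp: indicator_def)
    qed
    also have "\<dots> = A t + B t"
      unfolding A_def B_def v_def by (intro nn_integral_add) measurable
    finally show ?thesis unfolding v_def by simp
  qed
  then have "(\<integral>\<^sup>+t. ennreal (exp ((u (cis t))\<^sup>2)) \<partial>circ) \<le> (\<integral>\<^sup>+t. 1 + (A t + B t) \<partial>circ)"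
    by (intro nn_integral_mono)
  also have "\<dots> = ennreal (2 * pi) + ((\<integral>\<^sup>+t. A t \<partial>circ) + (\<integral>\<^sup>+t. B t \<partial>circ))"
    using mA by (subst nn_integral_add, simp, simp, subst nn_integral_add, simp, simp)
      (simp add: emeasure_circ[simplified])
  also have "\<dots> \<le> ennreal (2 * pi) + (ennreal layer_const + ennreal layer_const)"
    unfolding A_def B_def by (intro add_left_mono add_mono nn_integral_layers_le neg.nn_integral_layers_le)
  also have "\<dots> = ennreal (2 * pi + 2 * layer_const)"
    using layer_const_nonneg by (simp add: ennreal_plus[symmetric] del: ennreal_plus)
  finally show ?thesis .
qed

end

section \<open>The polar change of variables\<close>

text \<open>A linear map permuting coordinate axes sends boxes to boxes of equal volume. It
  identifies \<open>real^2\<close>, where the Jacobian determinant is taken, with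
  \<open>complex\<close> and with pairs of reals.\<close>

lemma lborel_distr_basis_bij:
  fixes T :: "'a::euclidean_space \<Rightarrow> 'b::euclidean_space"
  assumes T: "linear T" and bij: "bij_betw T Basis Basis"
  shows "distr lborel borel T = lborel"
proof (rule lborel_eqI[symmetric])
  have meas: "T \<in> borel_measurable borel"
    using T by (intro borel_measurable_continuous_onI linear_continuous_on)
      (simp add: linear_conv_bounded_linear)
  fix l r :: 'b assume lr: "\<And>b. b \<in> Basis \<Longrightarrow> l \<bullet> b \<le> r \<bullet> b"
  have TB: "T b \<in> Basis" if "b \<in> Basis" for b
    using bij that by (auto dest: bij_betwE)
  have inner: "T x \<bullet> T b = x \<bullet> b" if b: "b \<in> Basis" for x b
  proof -
    have "T x = T (\<Sum>c\<in>Basis. (x \<bullet> c) *\<^sub>R c)" by (simp add: euclidean_representation)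
    also have "\<dots> = (\<Sum>c\<in>Basis. (x \<bullet> c) *\<^sub>R T c)"
      using T by (simp add: linear_sum linear_scale)
    finally have "T x \<bullet> T b = (\<Sum>c\<in>Basis. (x \<bullet> c) * (T c \<bullet> T b))"
      by (simp add: inner_sum_left)
    also have "\<dots> = (\<Sum>c\<in>Basis. if c = b then x \<bullet> c else 0)"
    proof (intro sum.cong refl)
      fix c :: 'a assume c: "c \<in> Basis"
      have "T c = T b \<longleftrightarrow> c = b"
        using bij c b by (auto simp: bij_betw_def inj_on_def)
      then show "(x \<bullet> c) * (T c \<bullet> T b) = (if c = b then x \<bullet> c else 0)"
        using TB[OF c] TB[OF b] by (simp add: inner_Basis)
    qed
    also have "\<dots> = x \<bullet> b" using b by simp
    finally show ?thesis .
  qed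
  define S where "S = (\<lambda>v. \<Sum>b\<in>Basis. (v \<bullet> T b) *\<^sub>R b)"
  have S: "S v \<bullet> b = v \<bullet> T b" if "b \<in> Basis" for v b
    using that by (simp add: S_def)
  have "T -` box l r = box (S l) (S r)"
  proof (intro set_eqI)
    fix x
    have "x \<in> T -` box l r \<longleftrightarrow> (\<forall>c\<in>T ` Basis. l \<bullet> c < T x \<bullet> c \<and> T x \<bullet> c < r \<bullet> c)"
      using bij by (simp add: mem_box bij_betw_def)
    then show "x \<in> T -` box l r \<longleftrightarrow> x \<in> box (S l) (S r)"
      by (simp add: mem_box inner S)
  qed
  then have "emeasure (distr lborel borel T) (box l r) = emeasure lborel (box (S l) (S r))"
    using meas by (simp add: emeasure_distr)
  also have "\<dots> = (\<Prod>b\<in>Basis. (S r - S l) \<bullet> b)"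
    using lr TB by (subst emeasure_lborel_box) (auto simp: S)
  also have "(\<Prod>b\<in>Basis. (S r - S l) \<bullet> b) = (\<Prod>b\<in>Basis. (r - l) \<bullet> T b)"
    by (intro prod.cong) (auto simp: S inner_diff_left)
  also have "\<dots> = (\<Prod>b\<in>Basis. (r - l) \<bullet> b)"
    by (rule prod.reindex_bij_betw[OF bij])
  finally show "emeasure (distr lborel borel T) (box l r) = (\<Prod>b\<in>Basis. (r - l) \<bullet> b)" .
qed simp

section \<open>Polar coordinates as a change of variables on \<open>real^2\<close>\<close>

lemma Basis_vec2: "(Basis :: (real^2) set) = {axis 1 1, axis 2 1}"
  by (auto simp: Basis_vec_def UNIV_2)

lemma lborel_distr_vec2_complex:
  "distr lborel borel (\<lambda>v::real^2. Complex (v $ 1) (v $ 2)) = lborel"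
proof (rule lborel_distr_basis_bij)
  show "linear (\<lambda>v::real^2. Complex (v $ 1) (v $ 2))"
    by (rule linearI) (auto simp: complex_eq_iff)
  show "bij_betw (\<lambda>v::real^2. Complex (v $ 1) (v $ 2)) Basis Basis"
    unfolding bij_betw_def Basis_vec2 Basis_complex_def
    by (auto simp: axis_def complex_eq_iff inj_on_def)
qed

lemma lborel_distr_vec2_prod:
  "distr lborel borel (\<lambda>v::real^2. (v $ 1, v $ 2)) = lborel"
proof (rule lborel_distr_basis_bij)
  show "linear (\<lambda>v::real^2. (v $ 1, v $ 2))"
    by (rule linearI) auto
  show "bij_betw (\<lambda>v::real^2. (v $ 1, v $ 2)) Basis Basis"
    unfolding bij_betw_def Basis_vec2 Basis_prod_def
    by (auto simp: axis_def inj_on_def)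
qed

definition polar_map :: "real^2 \<Rightarrow> real^2" where
  "polar_map v = vector [v $ 1 * cos (v $ 2), v $ 1 * sin (v $ 2)]"

definition polar_deriv :: "real^2 \<Rightarrow> real^2 \<Rightarrow> real^2" where
  "polar_deriv v h = vector [h $ 1 * cos (v $ 2) - v $ 1 * sin (v $ 2) * h $ 2,
     h $ 1 * sin (v $ 2) + v $ 1 * cos (v $ 2) * h $ 2]"

lemma polar_map_has_derivative: "(polar_map has_derivative polar_deriv v) (at v within S)"
proof -
  have c: "((\<lambda>v::real^2. v $ i) has_derivative (\<lambda>h. h $ i)) (at v within S)" for i
    by (rule bounded_linear.has_derivative[OF bounded_linear_vec_nth has_derivative_ident])
  show ?thesis
    unfolding has_derivative_componentwise_within[of polar_map]
  proof
    fix b :: "real^2" assume "b \<in> Basis"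
    then consider "b = axis 1 1" | "b = axis 2 1" by (auto simp: Basis_vec2)
    then show "((\<lambda>x. polar_map x \<bullet> b) has_derivative (\<lambda>x. polar_deriv v x \<bullet> b)) (at v within S)"
      by cases (auto simp: inner_axis polar_map_def polar_deriv_def algebra_simps intro!: derivative_eq_intros c)
  qed
qed

lemma det_polar_deriv: "det (matrix (polar_deriv v)) = v $ 1"
proof -
  have "v $ 1 * (cos (v $ 2) * cos (v $ 2)) + v $ 1 * (sin (v $ 2) * sin (v $ 2)) = v $ 1"
    by (simp only: distrib_left[symmetric] sin_cos_squared_add3 mult_1_right)
  then show ?thesis
    by (simp add: det_2 matrix_def polar_deriv_def axis_def algebra_simps)
qed

text \<open>The open box excludes radius 0 and the double angle 0 = 2 pi, which makes
  \<open>polar_map\<close> injective on it.\<close>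

definition polar_box :: "(real^2) set" where
  "polar_box = box 0 (vector [1, 2*pi])"

lemma mem_polar_box: "v \<in> polar_box \<longleftrightarrow> 0 < v $ 1 \<and> v $ 1 < 1 \<and> 0 < v $ 2 \<and> v $ 2 < 2 * pi"
  unfolding polar_box_def mem_box Basis_vec2 by (auto simp: inner_axis)

lemma rcis_polar_map: "Complex (polar_map v $ 1) (polar_map v $ 2) = rcis (v $ 1) (v $ 2)"
  by (simp add: polar_map_def complex_eq_iff)

lemma inj_on_polar_map: "inj_on polar_map polar_box"
proof (rule inj_onI)
  fix v w assume v: "v \<in> polar_box" and w: "w \<in> polar_box" and eq: "polar_map v = polar_map w"
  have arg: "Arg2pi (cis a) = a" if "0 < a" "a < 2 * pi" for a
    by (rule Arg2pi_unique[of 1]) (use that in \<open>auto simp: cis_conv_exp\<close>)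
  have e: "rcis (v $ 1) (v $ 2) = rcis (w $ 1) (w $ 2)"
    unfolding rcis_polar_map[symmetric] eq ..
  have "norm (rcis (v $ 1) (v $ 2)) = norm (rcis (w $ 1) (w $ 2))" using e by simp
  then have 1: "v $ 1 = w $ 1" using v w by (simp add: mem_polar_box)
  then have c: "cis (v $ 2) = cis (w $ 2)"
    using e v by (simp add: rcis_def mem_polar_box)
  have "v $ 2 = Arg2pi (cis (v $ 2))" "Arg2pi (cis (w $ 2)) = w $ 2"
    using v w by (auto simp: mem_polar_box intro!: arg arg[symmetric])
  then have "v $ 2 = w $ 2"
    unfolding c by (rule trans)
  with 1 show "v = w" by (simp add: vec_eq_iff forall_2)
qed

lemma polar_integral_eq_vec2:
  fixes h :: "real \<times> real \<Rightarrow> real"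
  assumes h: "continuous_on UNIV h"
  shows "integral\<^sup>L polar h = integral polar_box (\<lambda>v. h (v $ 1, v $ 2))"
    and "(\<lambda>v. h (v $ 1, v $ 2)) absolutely_integrable_on polar_box"
proof -
  let ?I = "\<lambda>x. indicator ({0..1} \<times> {0..2*pi}) x *\<^sub>R h x"
  have iI: "integrable lborel ?I"
    by (intro borel_integrable_compact compact_Times continuous_on_subset[OF h]) auto
  then have iI': "integrable (lborel \<Otimes>\<^sub>M lborel) ?I" by (simp add: lborel_prod)
  have "integral\<^sup>L polar h = (LINT r|lborel. indicator {0..1} r *\<^sub>R (LINT t|lborel. indicator {0..2*pi} t *\<^sub>R h (r, t)))"
    unfolding integral_polar_fst[OF h] by (simp add: rad_def circ_def integral_restrict_space)
  also have "\<dots> = (LINT r|lborel. LINT t|lborel. ?I (r, t))"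
    by (intro Bochner_Integration.integral_cong refl) (auto simp: indicator_def)
  also have "\<dots> = integral\<^sup>L (lborel \<Otimes>\<^sub>M lborel) ?I"
    by (rule lborel_pair.integral_fst'[OF iI'])
  also have "\<dots> = integral\<^sup>L (distr lborel borel (\<lambda>v::real^2. (v $ 1, v $ 2))) ?I"
    by (simp add: lborel_distr_vec2_prod lborel_prod)
  also have "\<dots> = (integral\<^sup>L lborel (\<lambda>v::real^2. ?I (v $ 1, v $ 2)))"
    using iI by (subst integral_distr) auto
  also have "\<dots> = (integral\<^sup>L lborel (\<lambda>v::real^2. indicator (cbox 0 (vector [1, 2*pi])) v *\<^sub>R h (v $ 1, v $ 2)))"
    by (intro Bochner_Integration.integral_cong refl)
      (auto simp: indicator_def mem_box Basis_vec2 inner_axis)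
  finally have 1: "integral\<^sup>L polar h = (integral\<^sup>L lborel (\<lambda>v::real^2. indicator (cbox 0 (vector [1, 2*pi])) v *\<^sub>R h (v $ 1, v $ 2)))" .
  have c: "continuous_on UNIV (\<lambda>v::real^2. h (v $ 1, v $ 2))"
    by (intro continuous_on_compose2[OF h] continuous_intros) auto
  have s: "set_integrable lborel (cbox 0 (vector [1, 2*pi])) (\<lambda>v::real^2. h (v $ 1, v $ 2))"
    unfolding set_integrable_def by (intro borel_integrable_compact continuous_on_subset[OF c]) auto
  show "integral\<^sup>L polar h = integral polar_box (\<lambda>v. h (v $ 1, v $ 2))"
    using set_borel_integral_eq_integral(2)[OF s] 1
    unfolding polar_box_def integral_open_interval set_lebesgue_integral_def by simp
  have "(\<lambda>v::real^2. h (v $ 1, v $ 2)) absolutely_integrable_on (cbox 0 (vector [1, 2*pi]))"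
    by (intro absolutely_integrable_continuous continuous_on_subset[OF c]) auto
  then show "(\<lambda>v. h (v $ 1, v $ 2)) absolutely_integrable_on polar_box"
    unfolding polar_box_def by (rule set_integrable_subset) (auto simp: box_subset_cbox)
qed

lemma disk_integral_eq_vec2:
  fixes F :: "complex \<Rightarrow> real"
  assumes F: "continuous_on UNIV F"
  shows "integral\<^sup>L (lebesgue_on (ball 0 1)) F = integral (ball 0 1) (\<lambda>v::real^2. F (Complex (v $ 1) (v $ 2)))"
    and "(\<lambda>v::real^2. F (Complex (v $ 1) (v $ 2))) absolutely_integrable_on ball 0 1"
proof -
  have cC: "continuous_on UNIV (\<lambda>v::real^2. Complex (v $ 1) (v $ 2))"
    unfolding Complex_eq by (intro continuous_intros)
  have c: "continuous_on UNIV (\<lambda>v::real^2. F (Complex (v $ 1) (v $ 2)))"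
    by (intro continuous_on_compose2[OF F cC]) auto
  have a: "(\<lambda>v::real^2. F (Complex (v $ 1) (v $ 2))) absolutely_integrable_on ball 0 1"
  proof -
    have "integrable lborel (\<lambda>v::real^2. indicator (cball 0 1) v *\<^sub>R F (Complex (v $ 1) (v $ 2)))"
      by (intro borel_integrable_compact continuous_on_subset[OF c]) auto
    then have "set_integrable lborel (cball 0 1) (\<lambda>v::real^2. F (Complex (v $ 1) (v $ 2)))"
      by (simp add: set_integrable_def)
    then have "set_integrable lborel (ball 0 1) (\<lambda>v::real^2. F (Complex (v $ 1) (v $ 2)))"
      by (rule set_integrable_subset) auto
    then show ?thesis
      unfolding set_integrable_def by (simp add: integrable_completion)
  qed
  then show "(\<lambda>v::real^2. F (Complex (v $ 1) (v $ 2))) absolutely_integrable_on ball 0 1" .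
  have Fm: "F \<in> borel_measurable borel"
    using F by (rule borel_measurable_continuous_onI)
  let ?I = "\<lambda>z. indicator (ball 0 1) z *\<^sub>R F z"
  have m: "?I \<in> borel_measurable borel"
    by (intro borel_measurable_scaleR borel_measurable_indicator Fm) auto
  have nC: "norm (Complex (v $ 1) (v $ 2)) = norm v" for v :: "real^2"
    by (simp add: complex_norm norm_vec_def L2_set_def UNIV_2)
  have "integral\<^sup>L (lebesgue_on (ball 0 1)) F = integral\<^sup>L lebesgue ?I"
    by (subst integral_restrict_space) auto
  also have "\<dots> = integral\<^sup>L lborel ?I"
    using m by (subst integral_completion) auto
  also have "\<dots> = integral\<^sup>L (distr lborel borel (\<lambda>v::real^2. Complex (v $ 1) (v $ 2))) ?I"
    by (simp add: lborel_distr_vec2_complex)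
  also have "\<dots> = (integral\<^sup>L lborel (\<lambda>v::real^2. ?I (Complex (v $ 1) (v $ 2))))"
    using m cC by (intro integral_distr) (auto intro: borel_measurable_continuous_onI)
  also have "\<dots> = (integral\<^sup>L lborel (\<lambda>v::real^2. indicator (ball 0 1) v *\<^sub>R F (Complex (v $ 1) (v $ 2))))"
    by (intro Bochner_Integration.integral_cong refl) (simp add: indicator_def nC)
  also have "\<dots> = (integral\<^sup>L lebesgue (\<lambda>v::real^2. indicator (ball 0 1) v *\<^sub>R F (Complex (v $ 1) (v $ 2))))"
    using borel_measurable_continuous_onI[OF c]
    by (subst integral_completion) (auto intro!: borel_measurable_times borel_measurable_indicator)
  also have "\<dots> = integral (ball 0 1) (\<lambda>v::real^2. F (Complex (v $ 1) (v $ 2)))"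
    using set_lebesgue_integral_eq_integral(2)[OF a] unfolding set_lebesgue_integral_def by simp
  finally show "integral\<^sup>L (lebesgue_on (ball 0 1)) F = integral (ball 0 1) (\<lambda>v::real^2. F (Complex (v $ 1) (v $ 2)))" .
qed

text \<open>The image of the open box lies in the disk and omits a radius. For nonnegative
  \<open>F\<close> this inclusion already gives the inequality, in the direction that bounds
  \<open>energy\<close> by the Dirichlet integral over the disk.\<close>

lemma polar_integral_le_disk_integral:
  fixes F :: "complex \<Rightarrow> real"
  assumes F: "continuous_on UNIV F" and nonneg: "\<And>z. 0 \<le> F z"
  shows "(LINT x|polar. fst x * F (rcis (fst x) (snd x))) \<le> (LINT z|lebesgue_on (ball 0 1). F z)"
proof -
  define f where "f = (\<lambda>v::real^2. F (Complex (v $ 1) (v $ 2)))"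
  define h where "h = (\<lambda>x. fst x * F (rcis (fst x) (snd x)))"
  have h: "continuous_on UNIV h"
    unfolding h_def by (intro continuous_intros continuous_on_compose2[OF F]) auto
  define b where "b = integral polar_box (\<lambda>v. h (v $ 1, v $ 2))"
  \<comment> \<open>The change of variables theorem is applied to vector-valued integrands, so real
    values are wrapped into \<open>real^1\<close> and unwrapped afterwards.\<close>
  define f1 :: "real^2 \<Rightarrow> real^1" where "f1 = (\<lambda>v. vec (f v))"
  have eq: "(\<lambda>v. \<bar>det (matrix (polar_deriv v))\<bar> *\<^sub>R f1 (polar_map v)) v = (vec (h (v $ 1, v $ 2)) :: real^1)" if "v \<in> polar_box" for v
    using that by (simp add: det_polar_deriv f1_def f_def h_def rcis_polar_map mem_polar_box vec_eq_iff)
  have "(\<lambda>v. \<bar>det (matrix (polar_deriv v))\<bar> *\<^sub>R f1 (polar_map v)) absolutely_integrable_on polar_box \<and>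
      integral polar_box (\<lambda>v. \<bar>det (matrix (polar_deriv v))\<bar> *\<^sub>R f1 (polar_map v)) = vec b"
  proof
    have "(\<lambda>v. vec (h (v $ 1, v $ 2)) :: real^1) absolutely_integrable_on polar_box"
      unfolding absolutely_integrable_on_1_iff using polar_integral_eq_vec2(2)[OF h] by simp
    then show "(\<lambda>v. \<bar>det (matrix (polar_deriv v))\<bar> *\<^sub>R f1 (polar_map v)) absolutely_integrable_on polar_box"
      by (rule set_integrable_cong[THEN iffD1, rotated -1]) (use eq in auto)
    have "integral polar_box (\<lambda>v. \<bar>det (matrix (polar_deriv v))\<bar> *\<^sub>R f1 (polar_map v))
      = integral polar_box (\<lambda>v. vec (h (v $ 1, v $ 2)) :: real^1)"
      by (rule integral_cong) (use eq in auto)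
    then show "integral polar_box (\<lambda>v. \<bar>det (matrix (polar_deriv v))\<bar> *\<^sub>R f1 (polar_map v)) = vec b"
      unfolding integral_on_1_eq b_def by simp
  qed
  then have "f1 absolutely_integrable_on (polar_map ` polar_box) \<and> integral (polar_map ` polar_box) f1 = vec b"
    by (rule has_absolute_integral_change_of_variables[OF _ polar_map_has_derivative inj_on_polar_map, THEN iffD1, rotated])
       (simp add: polar_box_def)
  then have f: "f absolutely_integrable_on (polar_map ` polar_box)" "integral (polar_map ` polar_box) f = b"
    unfolding absolutely_integrable_on_1_iff integral_on_1_eq f1_def by (auto simp: vec_eq_iff)
  have "polar_map ` polar_box \<subseteq> ball 0 1"
  proof safe
    fix v assume v: "v \<in> polar_box"
    have "norm (polar_map v) = norm (rcis (v $ 1) (v $ 2))"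
      unfolding rcis_polar_map[symmetric] by (simp add: complex_norm norm_vec_def L2_set_def UNIV_2)
    then show "polar_map v \<in> ball 0 1"
      using v by (simp add: mem_polar_box)
  qed
  then have "integral (polar_map ` polar_box) f \<le> integral (ball 0 1) f"
    using f(1) disk_integral_eq_vec2(2)[OF F] nonneg
    by (intro integral_subset_le) (auto simp: f_def absolutely_integrable_on_def)
  then show ?thesis
    using polar_integral_eq_vec2(1)[OF h] disk_integral_eq_vec2(1)[OF F] f(2)
    unfolding b_def f_def h_def by simp
qed

section \<open>The Sobolev case\<close>

lemma grad_inner:
  assumes "f differentiable at x"
  shows "(f has_derivative (\<lambda>h. grad f x \<bullet> h)) (at x)"
proof -
  have d: "(f has_derivative frechet_derivative f (at x)) (at x)"
    using assms by (simp add: frechet_derivative_works)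
  have "frechet_derivative f (at x) h = grad f x \<bullet> h" for h
  proof -
    interpret linear "frechet_derivative f (at x)"
      using d by (rule has_derivative_linear)
    have "frechet_derivative f (at x) h = frechet_derivative f (at x) (\<Sum>b\<in>Basis. (h \<bullet> b) *\<^sub>R b)"
      by (simp add: euclidean_representation)
    also have "\<dots> = (\<Sum>b\<in>Basis. (h \<bullet> b) * frechet_derivative f (at x) b)"
      by (simp add: sum scale)
    finally show ?thesis
      by (simp add: grad_def inner_commute[of _ h] inner_sum_right mult.commute)
  qed
  then have "frechet_derivative f (at x) = (\<lambda>h. grad f x \<bullet> h)" by (rule ext)
  then show ?thesis using d by simp
qed

lemma smooth_C1_gradient:
  fixes f :: "complex \<Rightarrow> real"
  assumes "smooth f"
  shows "C1_gradient f (grad f)"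
proof -
  have "C_k (Suc 0) f" using assms by (simp add: smooth_def)
  then have d: "\<And>x. f differentiable at x" and c: "\<And>b. b \<in> Basis \<Longrightarrow> continuous_on UNIV (\<lambda>x. grad f x \<bullet> b)"
    by simp_all
  show ?thesis
    unfolding C1_gradient_def using d c grad_inner by (auto intro: continuous_on_componentwise[THEN iffD2])
qed

lemma integral_lebesgue_circ:
  fixes f :: "real \<Rightarrow> real"
  assumes "f \<in> borel_measurable borel"
  shows "(LINT t|lebesgue_on {0..2*pi}. f t) = (LINT t|circ. f t)"
proof -
  have "(LINT t|lebesgue_on {0..2*pi}. f t) = (LINT t|lebesgue. indicator {0..2*pi} t *\<^sub>R f t)"
    by (subst integral_restrict_space) auto
  also have "\<dots> = (LINT t|lborel. indicator {0..2*pi} t *\<^sub>R f t)"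
    using assms by (intro integral_completion) (auto intro!: borel_measurable_times borel_measurable_indicator)
  finally show ?thesis
    by (simp add: circ_def integral_restrict_space)
qed

lemma nn_integral_lebesgue_circ:
  "(\<integral>\<^sup>+t. f t \<partial>lebesgue_on {0..2*pi}) = (\<integral>\<^sup>+t. f t \<partial>circ)"
  by (simp add: circ_def nn_integral_restrict_space nn_integral_completion)

lemma power2_diff_le: "(a - b)\<^sup>2 \<le> 2 * a\<^sup>2 + 2 * (b::real)\<^sup>2"
  using zero_le_power2[of "a + b"] by (simp add: power2_eq_square algebra_simps)

text \<open>Young's inequality with a parameter. The factor in front of the norm of \<open>b\<close>
  can be brought close to 1; a fixed factor such as 2 would lose the critical exponent in the
  limit.\<close>

lemma power2_norm_diff_le:
  fixes a b :: "'a::real_inner"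
  assumes "0 < h"
  shows "(norm a)\<^sup>2 \<le> (1 + h) * (norm b)\<^sup>2 + (1 + 1 / h) * (norm (a - b))\<^sup>2"
proof -
  define x y where "x = norm b" and "y = norm (a - b)"
  have "norm a \<le> x + y"
    unfolding x_def y_def by norm
  then have "(norm a)\<^sup>2 \<le> (x + y)\<^sup>2" by (intro power_mono) auto
  also have "\<dots> \<le> (1 + h) * x\<^sup>2 + (1 + 1 / h) * y\<^sup>2"
  proof -
    have "0 \<le> (h * x - y)\<^sup>2 / h" using assms by simp
    also have "\<dots> = h * x\<^sup>2 + y\<^sup>2 / h - 2 * x * y"
      using assms by (simp add: power2_eq_square field_simps)
    finally show ?thesis by (simp add: power2_eq_square algebra_simps)
  qed
  finally show ?thesis unfolding x_def y_def .
qed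

lemma energy_scaleR: "energy (\<lambda>z. c *\<^sub>R G z) = c\<^sup>2 * energy G"
proof -
  have "fst x * (norm (c *\<^sub>R G z))\<^sup>2 = c\<^sup>2 * (fst x * (norm (G z))\<^sup>2)" for x :: "real \<times> real" and z
    by (simp add: power_mult_distrib)
  then show ?thesis
    unfolding energy_def by (simp only: integral_mult_right_zero)
qed

lemma C1_gradient_affine:
  assumes "C1_gradient u G"
  shows "C1_gradient (\<lambda>z. c * (u z - m)) (\<lambda>z. c *\<^sub>R G z)"
proof -
  have "((\<lambda>s. c * (s - m)) has_real_derivative c) (at s)" for s
    by (auto intro!: derivative_eq_intros)
  from C1_gradient_comp[OF assms this] show ?thesis by simp
qed

theorem corollaryE:
  "\<exists>C::real. \<forall>(v :: complex \<Rightarrow> real) (g :: complex \<Rightarrow> real).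
     v \<in> W12 (ball 0 1) \<longrightarrow>
     has_trace_disk v g \<longrightarrow>
     (LINT \<theta>|lebesgue_on {0..2*pi}. g (cis \<theta>)) = 0 \<longrightarrow>
     (LINT z|lebesgue_on (ball 0 1). (norm (weak_gradient (ball 0 1) v z))\<^sup>2 / pi) \<le> 1 \<longrightarrow>
     (\<integral>\<^sup>+ \<theta>. ennreal (exp ((g (cis \<theta>))\<^sup>2)) \<partial>lebesgue_on {0..2*pi}) \<le> ennreal C"
proof (intro exI[of _ "2 * pi + 2 * layer_const"] allI impI)
  fix v g :: "complex \<Rightarrow> real"
  assume v: "v \<in> W12 (ball 0 1)" and trace: "has_trace_disk v g"
    and g_mean: "(LINT \<theta>|lebesgue_on {0..2*pi}. g (cis \<theta>)) = 0"
    and v_energy: "(LINT z|lebesgue_on (ball 0 1). (norm (weak_gradient (ball 0 1) v z))\<^sup>2 / pi) \<le> 1"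
  define C where "C = lebesgue_on {0..2*pi}"
  define D where "D = lebesgue_on (ball (0::complex) 1)"
  define G where "G = weak_gradient (ball 0 1) v"
  define h where "h = (\<lambda>t. g (cis t))"
  interpret C: finite_measure C
    by standard (simp add: C_def space_restrict_space emeasure_restrict_space)
  interpret D: finite_measure D
    by standard (use emeasure_lborel_ball_finite[of "0::complex" 1] in \<open>simp add: D_def space_restrict_space emeasure_restrict_space\<close>)
  \<comment> \<open>\<open>weak_gradient\<close> is a choice, and only membership in
    \<open>W12\<close> makes it a square-integrable weak gradient. This gives content to the energy
    hypothesis, since the integral of a nonintegrable function is 0 by default.\<close>
  have "G \<in> L2 (ball 0 1)"
  proof -
    have "\<exists>G. G \<in> L2 (ball 0 1) \<and> has_weak_gradient (ball 0 1) v G"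
      using v by (simp add: W12_def)
    from someI_ex[OF this] show ?thesis
      unfolding G_def weak_gradient_def by blast
  qed
  then have Gm [measurable]: "G \<in> borel_measurable D" and G2: "integrable D (\<lambda>z. (norm (G z))\<^sup>2)"
    by (auto simp: L2_def D_def)
  have hm [measurable]: "h \<in> borel_measurable C" and h2: "integrable C (\<lambda>t. (h t)\<^sup>2)"
    using trace by (auto simp: has_trace_disk_def L2_def C_def h_def)
  obtain u where u: "\<And>n. smooth (u n)"
    and u_grad: "(\<lambda>n. LINT z|D. (norm (grad (u n) z - G z))\<^sup>2) \<longlonglongrightarrow> 0"
    and u_trace: "(\<lambda>n. LINT \<theta>|C. (u n (cis \<theta>) - h \<theta>)\<^sup>2) \<longlonglongrightarrow> 0"
    using trace unfolding has_trace_disk_def C_def D_def G_def h_def by blast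
  define d where "d = (\<lambda>n. LINT z|D. (norm (grad (u n) z - G z))\<^sup>2)"
  define c where "c = (\<lambda>n. LINT \<theta>|C. (u n (cis \<theta>) - h \<theta>)\<^sup>2)"
  define m where "m = (\<lambda>n. (LINT \<theta>|C. u n (cis \<theta>)) / (2 * pi))"
  \<comment> \<open>The square root ensures d n <= eta^2, so that (1 + 1/eta) d n tends to 0, and
    the second summand keeps eta positive even when d n = 0.\<close>
  define \<eta> where "\<eta> = (\<lambda>n. sqrt (d n) + 1 / (real n + 1))"
  have d0: "0 \<le> d n" for n unfolding d_def by simp
  have \<eta>0: "0 < \<eta> n" for n unfolding \<eta>_def using d0[of n] by (simp add: add_nonneg_pos)
  have C1: "C1_gradient (u n) (grad (u n))" for n
    by (rule smooth_C1_gradient[OF u])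
  have cgrad: "continuous_on UNIV (grad (u n))" for n
    using C1[of n] by (simp add: C1_gradient_def)
  have cu: "continuous_on UNIV (\<lambda>t. u n (cis t))" for n
    by (intro continuous_on_compose2[OF C1_gradient_continuous[OF C1]] continuous_intros) auto
  have cuC: "(\<lambda>t. u n (cis t)) \<in> borel_measurable borel" for n
    using cu by (rule borel_measurable_continuous_onI)
  have [measurable]: "grad (u n) \<in> borel_measurable D" for n
    using borel_measurable_continuous_onI[OF cgrad[of n]]
    unfolding D_def by (intro measurable_restrict_space1 measurable_completion) simp
  have [measurable]: "(\<lambda>t. u n (cis t)) \<in> borel_measurable C" for n
    using cuC[of n] unfolding C_def by (intro measurable_restrict_space1 measurable_completion) simp
  have iu: "integrable C (\<lambda>t. f (u n (cis t)))" if f: "continuous_on UNIV f" for f :: "real \<Rightarrow> real" and n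
    unfolding C_def by (intro continuous_imp_integrable_real continuous_on_subset[OF continuous_on_compose2[OF f cu]]) auto
  have ig: "integrable D (\<lambda>z. (norm (grad (u n) z))\<^sup>2)" for n
  proof -
    have "bounded (grad (u n) ` cball 0 1)"
      by (intro compact_imp_bounded compact_continuous_image continuous_on_subset[OF cgrad]) auto
    then obtain B where "\<forall>z\<in>cball 0 1. norm (grad (u n) z) \<le> B"
      unfolding bounded_iff by auto
    then show ?thesis
      by (intro D.integrable_const_bound[of _ "B\<^sup>2"] AE_I2)
         (simp add: D_def space_restrict_space power_mono, measurable)
  qed
  \<comment> \<open>Without integrability the convergence \<open>u_grad\<close> would say nothing,
    because of the default value 0; \<open>id2\<close> plays the same part on the boundary.\<close>
  have idiff: "integrable D (\<lambda>z. (norm (grad (u n) z - G z))\<^sup>2)" for n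
  proof (rule Bochner_Integration.integrable_bound)
    show "integrable D (\<lambda>z. 2 * (norm (grad (u n) z))\<^sup>2 + 2 * (norm (G z))\<^sup>2)"
      using ig G2 by simp
    have "(norm (grad (u n) z - G z))\<^sup>2 \<le> 2 * (norm (grad (u n) z))\<^sup>2 + 2 * (norm (G z))\<^sup>2" for z
      using power2_norm_diff_le[of 1 "grad (u n) z - G z" "grad (u n) z"] by simp
    then show "AE z in D. norm ((norm (grad (u n) z - G z))\<^sup>2) \<le> norm (2 * (norm (grad (u n) z))\<^sup>2 + 2 * (norm (G z))\<^sup>2)"
      by (intro AE_I2) simp
  qed measurable
  have energy: "energy (grad (u n)) \<le> (1 + \<eta> n)\<^sup>2 * pi" for n
  proof -
    have G_pi: "(LINT z|D. (norm (G z))\<^sup>2) \<le> pi"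
      using v_energy unfolding D_def[symmetric] G_def[symmetric] by simp
    have "energy (grad (u n)) \<le> (LINT z|D. (norm (grad (u n) z))\<^sup>2)"
      unfolding energy_def D_def by (intro polar_integral_le_disk_integral continuous_intros cgrad) auto
    also have "\<dots> \<le> (LINT z|D. (1 + \<eta> n) * (norm (G z))\<^sup>2 + (1 + 1 / \<eta> n) * (norm (grad (u n) z - G z))\<^sup>2)"
      using ig idiff G2 by (intro integral_mono power2_norm_diff_le \<eta>0) auto
    also have "\<dots> = (1 + \<eta> n) * (LINT z|D. (norm (G z))\<^sup>2) + (1 + 1 / \<eta> n) * d n"
      unfolding d_def using idiff G2 by simp
    also have "\<dots> \<le> (1 + \<eta> n) * pi + ((\<eta> n)\<^sup>2 + \<eta> n)"
    proof (intro add_mono mult_left_mono G_pi)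
      have "sqrt (d n) \<le> \<eta> n" by (simp add: \<eta>_def)
      then have "(sqrt (d n))\<^sup>2 \<le> (\<eta> n)\<^sup>2" using d0 by (intro power_mono) auto
      then have "d n \<le> (\<eta> n)\<^sup>2" using d0[of n] by simp
      then have "(1 + 1 / \<eta> n) * d n \<le> (1 + 1 / \<eta> n) * (\<eta> n)\<^sup>2"
        using \<eta>0[of n] by (intro mult_left_mono) auto
      also have "\<dots> = (\<eta> n)\<^sup>2 + \<eta> n"
        using \<eta>0[of n] by (simp add: power2_eq_square field_simps)
      finally show "(1 + 1 / \<eta> n) * d n \<le> (\<eta> n)\<^sup>2 + \<eta> n" .
    qed (use \<eta>0[of n] in auto)
    \<comment> \<open>Bounding 1 by pi makes the sum the exact square
      \<open>(1 + \<eta> n)\<^sup>2 * pi\<close>, which division of the function by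
      \<open>1 + \<eta> n\<close> undoes.\<close>
    also have "\<dots> \<le> (1 + \<eta> n) * pi + ((\<eta> n)\<^sup>2 + \<eta> n) * pi"
    proof -
      have "((\<eta> n)\<^sup>2 + \<eta> n) * 1 \<le> ((\<eta> n)\<^sup>2 + \<eta> n) * pi"
        using \<eta>0[of n] pi_gt3 by (intro mult_left_mono) auto
      then show ?thesis by simp
    qed
    also have "\<dots> = (1 + \<eta> n)\<^sup>2 * pi"
      by (simp add: power2_eq_square algebra_simps)
    finally show ?thesis .
  qed
  define w where "w = (\<lambda>n z. inverse (1 + \<eta> n) * (u n z - m n))"
  have w_bound: "(\<integral>\<^sup>+t. ennreal (exp ((w n (cis t))\<^sup>2)) \<partial>C) \<le> ennreal (2 * pi + 2 * layer_const)" for n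
  proof -
    have "unit_energy (w n) (\<lambda>z. inverse (1 + \<eta> n) *\<^sub>R grad (u n) z)"
    proof
      show "C1_gradient (w n) (\<lambda>z. inverse (1 + \<eta> n) *\<^sub>R grad (u n) z)"
        unfolding w_def by (rule C1_gradient_affine[OF C1])
      show "(LINT t|circ. w n (cis t)) = 0"
        using integrable_circ[OF cu[of n]] integral_lebesgue_circ[OF cuC[of n]]
        unfolding w_def m_def C_def by (simp add: measure_circ)
      have "(inverse (1 + \<eta> n))\<^sup>2 * energy (grad (u n)) \<le> (inverse (1 + \<eta> n))\<^sup>2 * ((1 + \<eta> n)\<^sup>2 * pi)"
        by (intro mult_left_mono energy) auto
      also have "\<dots> = pi" using \<eta>0[of n] by (simp add: field_simps)
      finally show "energy (\<lambda>z. inverse (1 + \<eta> n) *\<^sub>R grad (u n) z) \<le> pi"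
        unfolding energy_scaleR .
    qed
    then show ?thesis
      unfolding C_def nn_integral_lebesgue_circ by (rule unit_energy.nn_integral_exp_square_le)
  qed
  have \<eta>_lim: "\<eta> \<longlonglongrightarrow> 0"
  proof -
    have "(\<lambda>n. sqrt (d n) + 1 / (real n + 1)) \<longlonglongrightarrow> sqrt 0 + 0"
      using u_grad LIMSEQ_inverse_real_of_nat unfolding d_def
      by (intro tendsto_add tendsto_real_sqrt) (auto simp: inverse_eq_divide add.commute)
    then show ?thesis by (simp add: \<eta>_def)
  qed
  have id2: "integrable C (\<lambda>t. (u n (cis t) - h t)\<^sup>2)" for n
  proof (rule Bochner_Integration.integrable_bound)
    show "integrable C (\<lambda>t. 2 * (u n (cis t))\<^sup>2 + 2 * (h t)\<^sup>2)"
      using iu[of "\<lambda>x. x\<^sup>2" n] h2 by (simp add: continuous_intros)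
    show "AE t in C. norm ((u n (cis t) - h t)\<^sup>2) \<le> norm (2 * (u n (cis t))\<^sup>2 + 2 * (h t)\<^sup>2)"
      using power2_diff_le by (intro AE_I2) simp
  qed measurable
  have ih: "integrable C h"
  proof (rule Bochner_Integration.integrable_bound)
    show "integrable C (\<lambda>t. 1 + (h t)\<^sup>2)" using h2 by simp
    have "\<bar>x\<bar> \<le> 1 + x\<^sup>2" for x :: real
      using zero_le_power2[of "\<bar>x\<bar> - 1 / 2"] by (simp add: power2_eq_square algebra_simps)
    then show "AE t in C. norm (h t) \<le> norm (1 + (h t)\<^sup>2)"
      by (intro AE_I2) simp
  qed measurable
  \<comment> \<open>As the trace has mean 0, \<open>2 * pi * m n\<close> is the integral of the
    difference from the trace, small by Cauchy-Schwarz against the constant 1.\<close>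
  have m_lim: "m \<longlonglongrightarrow> 0"
  proof -
    have "\<bar>2 * pi * m n\<bar> \<le> sqrt (c n) * sqrt (2 * pi)" for n
    proof -
      have iuh: "integrable C (\<lambda>t. u n (cis t) - h t)"
        using iu[of "\<lambda>x. x" n] ih by simp
      have "(LINT t|C. u n (cis t) - h t) = 2 * pi * m n"
        using iu[of "\<lambda>x. x" n] ih g_mean unfolding m_def by (simp add: C_def[symmetric] h_def[symmetric])
      moreover have "\<bar>LINT t|C. (u n (cis t) - h t) * 1\<bar> \<le> sqrt (c n) * sqrt (LINT t|C. 1\<^sup>2)"
        unfolding c_def using id2 iuh by (intro integral_Cauchy_Schwarz) auto
      moreover have "(LINT t|C. 1\<^sup>2) = 2 * pi"
        by (simp add: C_def measure_restrict_space)
      ultimately show ?thesis by simp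
    qed
    then have "norm (m n) \<le> sqrt (c n) * (sqrt (2 * pi) / (2 * pi))" for n
      by (simp add: abs_mult field_simps)
    moreover have "(\<lambda>n. sqrt (c n) * (sqrt (2 * pi) / (2 * pi))) \<longlonglongrightarrow> sqrt 0 * (sqrt (2 * pi) / (2 * pi))"
      using u_trace unfolding c_def[symmetric] by (intro tendsto_mult tendsto_real_sqrt tendsto_const)
    ultimately show ?thesis
      by (intro Lim_null_comparison[of m "\<lambda>n. sqrt (c n) * (sqrt (2 * pi) / (2 * pi))"] always_eventually) auto
  qed
  \<comment> \<open>Fatou requires pointwise convergence, which the L^2 convergence of the traces
    gives almost everywhere along a subsequence.\<close>
  obtain r :: "nat \<Rightarrow> nat" where r: "strict_mono r" "AE t in C. (\<lambda>n. (u (r n) (cis t) - h t)\<^sup>2) \<longlonglongrightarrow> 0"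
    using tendsto_L1_AE_subseq[of C "\<lambda>n t. (u n (cis t) - h t)\<^sup>2"] id2 u_trace by auto
  have "AE t in C. ennreal (exp ((h t)\<^sup>2)) \<le> liminf (\<lambda>n. ennreal (exp ((w (r n) (cis t))\<^sup>2)))"
    using r(2)
  proof eventually_elim
    case (elim t)
    have "(\<lambda>n. sqrt ((u (r n) (cis t) - h t)\<^sup>2)) \<longlonglongrightarrow> sqrt 0"
      using elim by (rule tendsto_real_sqrt)
    then have "(\<lambda>n. u (r n) (cis t) - h t) \<longlonglongrightarrow> 0"
      by (simp add: tendsto_rabs_zero_iff)
    then have "(\<lambda>n. u (r n) (cis t)) \<longlonglongrightarrow> h t"
      by (simp add: LIM_zero_iff)
    moreover have "(\<lambda>n. m (r n)) \<longlonglongrightarrow> 0" "(\<lambda>n. \<eta> (r n)) \<longlonglongrightarrow> 0"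
      using LIMSEQ_subseq_LIMSEQ[OF m_lim r(1)] LIMSEQ_subseq_LIMSEQ[OF \<eta>_lim r(1)] by (auto simp: o_def)
    ultimately have "(\<lambda>n. inverse (1 + \<eta> (r n)) * (u (r n) (cis t) - m (r n))) \<longlonglongrightarrow> inverse (1 + 0) * (h t - 0)"
      by (intro tendsto_intros) auto
    then have "(\<lambda>n. w (r n) (cis t)) \<longlonglongrightarrow> h t" by (simp add: w_def)
    then have "(\<lambda>n. ennreal (exp ((w (r n) (cis t))\<^sup>2))) \<longlonglongrightarrow> ennreal (exp ((h t)\<^sup>2))"
      by (intro tendsto_ennrealI tendsto_intros)
    from lim_imp_Liminf[OF trivial_limit_sequentially this] show ?case
      by simp
  qed
  then have "(\<integral>\<^sup>+t. ennreal (exp ((h t)\<^sup>2)) \<partial>C) \<le> (\<integral>\<^sup>+t. liminf (\<lambda>n. ennreal (exp ((w (r n) (cis t))\<^sup>2))) \<partial>C)"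
    by (rule nn_integral_mono_AE)
  also have "\<dots> \<le> liminf (\<lambda>n. (\<integral>\<^sup>+t. ennreal (exp ((w (r n) (cis t))\<^sup>2)) \<partial>C))"
    unfolding w_def by (rule nn_integral_liminf) measurable
  also have "\<dots> \<le> ennreal (2 * pi + 2 * layer_const)"
    by (intro Liminf_le always_eventually allI w_bound) simp
  finally show "(\<integral>\<^sup>+ \<theta>. ennreal (exp ((g (cis \<theta>))\<^sup>2)) \<partial>lebesgue_on {0..2*pi}) \<le> ennreal (2 * pi + 2 * layer_const)"
    unfolding h_def C_def .
qed

end
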